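(* Let $k\ge1$ and $n\ge0$ be integers. The polynomial component of the function $f_n(x_1,\dots,x_k)=\prod_{1\le i<j\le k}\frac{x_i-x_j}{x_i+x_j}\cdot (x_1+\dots+x_k)^{\underline{n}}$ equals $$P\left[\prod_{1\le i<j\le k}\frac{x_i-x_j}{x_i+x_j}\cdot (x_1+\dots+x_k)^{\underline{n}}\right]=\sum_{m_1+\dots+m_k=n}\ \prod_{1\le i<j\le k}\frac{m_i-m_j}{m_i+m_j}\cdot\frac{n!}{\prod_{i=1}^k m_i!}\cdot\prod_{i=1}^k x_i^{\underline{m_i}},$$ where the sum is over $k$-tuples of non-negative integers $m_1,\dots,m_k$ with sum $n$, and $\frac{m_i-m_j}{m_i+m_j}$ is taken to be $1$ when $m_i=m_j=0$.
   Context: Falling factorial: $x^{\underline{n}}=x(x-1)\cdots(x-n+1)$, $x^{\underline{0}}=1$. Let $\mathcal{M}$ be the set of rational functions in $x_1,\dots,x_k$ (with rational coefficients) of the form $p/\prod_{1\le i<j\le k}(x_i+x_j)$ with $p$ a polynomial. Functions in $\mathcal{M}$ are expanded as Laurent series in $x_1,x_2/x_1,x_3/x_2,\dots,x_k/x_{k-1}$, i.e. using $(x_i+x_j)^{-1}=x_i^{-1}-x_jx_i^{-2}+x_j^2x_i^{-3}-\dots$ for $i<j$. Each $f\in\mathcal{M}$ is then uniquely written as $f=P[f]+Q[f]$, where $P[f]$ (the polynomial component) is a polynomial in $x_1,\dots,x_k$ consisting of the terms of the expansion with all exponents non-negative, and $Q[f]$ (the antipolynomial component) consists of the terms $\prod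 x_i^{c_i}$ with at least one $c_i<0$. *)

theory Defs
  imports
    Complex_Main
    "HOL-Library.Poly_Mapping"
    "HOL-Library.FuncSet"
    "HOL-Computational_Algebra.Fraction_Field"
begin

section \<open>Polynomials and rational functions\<close>

type_synonym mpoly = "(nat \<Rightarrow>\<^sub>0 nat) \<Rightarrow>\<^sub>0 rat"
type_synonym mratfun = "mpoly fract"

definition pvar :: "nat \<Rightarrow> mpoly" where
  "pvar i = Poly_Mapping.single (Poly_Mapping.single i 1) 1"

definition pconst :: "rat \<Rightarrow> mpoly" where
  "pconst a = Poly_Mapping.single 0 a"

definition rvar :: "nat \<Rightarrow> mratfun" where
  "rvar i = Fract (pvar i) 1"

definition polys_in :: "nat \<Rightarrow> mpoly set" where
  "polys_in k = {p. \<forall>m\<in>Poly_Mapping.keys p. Poly_Mapping.keys m \<subseteq> {1..k}}"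

definition pairs :: "nat \<Rightarrow> (nat \<times> nat) set" where
  "pairs k = {(i, j). 1 \<le> i \<and> i < j \<and> j \<le> k}"

definition denom :: "nat \<Rightarrow> mpoly" where
  "denom k = (\<Prod>(i, j)\<in>pairs k. pvar i + pvar j)"

definition ratfuns :: "nat \<Rightarrow> mratfun set" where
  "ratfuns k = {Fract p (denom k) |p. p \<in> polys_in k}"

definition falling_factorial :: "'a :: comm_ring_1 \<Rightarrow> nat \<Rightarrow> 'a" where
  "falling_factorial x n = (\<Prod>i<n. x - of_nat i)"

lemma finite_pairs [simp]: "finite (pairs k)"
  by (rule finite_subset[of _ "{1..k} \<times> {1..k}"]) (auto simp: pairs_def)

lemma pvar_add_neq_0: "pvar i + pvar j \<noteq> 0"
proof
  assume "pvar i + pvar j = 0"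
  hence "Poly_Mapping.lookup (pvar i + pvar j) (Poly_Mapping.single i 1) = 0"
    by simp
  thus False
    by (simp add: lookup_add pvar_def lookup_single when_def split: if_splits)
qed

lemma denom_neq_0: "denom k \<noteq> 0"
  unfolding denom_def by (auto simp: prod_zero_iff pvar_add_neq_0)

text \<open>
  Well defined for \<open>f\<close> in \<open>ratfuns k\<close> only, see \<open>numerator_Fract\<close> below; the same holds for
  \<open>expansion\<close> and \<open>polynomial_component\<close>.
\<close>

definition numerator :: "nat \<Rightarrow> mratfun \<Rightarrow> mpoly" where
  "numerator k f = (THE p. p \<in> polys_in k \<and> f = Fract p (denom k))"

lemma numerator_Fract:
  assumes "p \<in> polys_in k"
  shows "numerator k (Fract p (denom k)) = p"
  unfolding numerator_def
  by (rule the_equality) (use assms in \<open>auto simp: eq_fract denom_neq_0\<close>)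


section \<open>Laurent series\<close>

text \<open>
  A monomial is given by its exponents \<open>c\<close>.  For a monomial in \<open>x 0, \<dots>, x (K-1)\<close>, the
  exponent of \<open>x i / x (i-1)\<close>, when it is written in terms of \<open>x 0, x 1 / x 0, x 2 / x 1, \<dots>\<close>,
  is \<open>c i + c (i+1) + \<dots> + c (K-1)\<close>.  A Laurent series in these quotients is thus a coefficient
  function supported in some \<open>lsupp K N\<close>.  (The series used below do not involve \<open>x 0\<close>, so
  they are series in \<open>x 1, x 2 / x 1, x 3 / x 2, \<dots>\<close>.)
\<close>

definition lsupp :: "nat \<Rightarrow> int \<Rightarrow> (nat \<Rightarrow>\<^sub>0 int) set" where
  "lsupp K N = {c. (\<forall>i\<ge>K. Poly_Mapping.lookup c i = 0) \<and> (\<forall>i. N \<le> (\<Sum>j=i..<K. Poly_Mapping.lookup c j))}"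

definition is_laurent :: "((nat \<Rightarrow>\<^sub>0 int) \<Rightarrow> rat) \<Rightarrow> bool" where
  "is_laurent f \<longleftrightarrow> (\<exists>K N. {c. f c \<noteq> 0} \<subseteq> lsupp K N)"

lemma lsupp_mono:
  assumes "K \<le> K'" "N' \<le> N"
  shows "lsupp K N \<subseteq> lsupp K' N'"
proof
  fix c assume c: "c \<in> lsupp K N"
  have "(\<Sum>j=i..<K'. Poly_Mapping.lookup c j) = (\<Sum>j=i..<K. Poly_Mapping.lookup c j)" for i
    by (rule sum.mono_neutral_right) (use c assms in \<open>auto simp: lsupp_def\<close>)
  thus "c \<in> lsupp K' N'"
    using c assms by (auto simp: lsupp_def intro: order_trans)
qed

lemma lsupp_add:
  assumes "a \<in> lsupp K N" "b \<in> lsupp K N'"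
  shows "a + b \<in> lsupp K (N + N')"
  using assms by (auto simp: lsupp_def lookup_add sum.distrib intro!: add_mono)

lemma finite_lsupp_diff: "finite {a. a \<in> lsupp K N \<and> c - a \<in> lsupp K N}"
proof -
  define B where "B = (\<Sum>j<K. \<bar>Poly_Mapping.lookup c j\<bar>)"
  define T where "T = (\<lambda>a i. \<Sum>j=i..<K. Poly_Mapping.lookup a j :: int)"
  have B: "T c i \<le> B" for i
  proof -
    have "T c i \<le> (\<Sum>j=i..<K. \<bar>Poly_Mapping.lookup c j\<bar>)"
      unfolding T_def by (rule sum_mono) auto
    also have "\<dots> \<le> B"
      unfolding B_def by (rule sum_mono2) auto
    finally show ?thesis .
  qed
  let ?F = "{g. \<forall>i. (i \<in> {..<K} \<longrightarrow> g i \<in> {2 * N - B..B - 2 * N}) \<and> (i \<notin> {..<K} \<longrightarrow> g i = 0)}"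
  have sub: "Poly_Mapping.lookup ` {a. a \<in> lsupp K N \<and> c - a \<in> lsupp K N} \<subseteq> ?F"
  proof (rule image_subsetI)
    fix a assume "a \<in> {a. a \<in> lsupp K N \<and> c - a \<in> lsupp K N}"
    hence a: "a \<in> lsupp K N" "c - a \<in> lsupp K N" by auto
    have 0: "Poly_Mapping.lookup a i = 0" if "i \<notin> {..<K}" for i
      using a that by (auto simp: lsupp_def)
    have 1: "N \<le> T a j" "T a j \<le> B - N" for j
    proof -
      show "N \<le> T a j" using a by (auto simp: lsupp_def T_def)
      have "N \<le> T (c - a) j" using a by (auto simp: lsupp_def T_def)
      also have "T (c - a) j = T c j - T a j"
        by (simp add: T_def lookup_minus sum_subtractf)
      finally show "T a j \<le> B - N" using B[of j] by linarith
    qed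
    have 2: "Poly_Mapping.lookup a i \<in> {2 * N - B..B - 2 * N}" if "i \<in> {..<K}" for i
    proof -
      have "T a i = Poly_Mapping.lookup a i + T a (Suc i)"
        using that unfolding T_def by (subst sum.atLeast_Suc_lessThan) auto
      thus ?thesis using 1[of i] 1[of "Suc i"] by auto
    qed
    show "Poly_Mapping.lookup a \<in> ?F" using 0 2 by blast
  qed
  have "finite ?F"
    by (rule finite_set_of_finite_funs) auto
  from finite_subset[OF sub this] show ?thesis
    by (rule finite_imageD) (auto simp: inj_on_def)
qed

lemma is_laurent_common:
  assumes "is_laurent f" "is_laurent g"
  obtains K N where "{c. f c \<noteq> 0} \<subseteq> lsupp K N" "{c. g c \<noteq> 0} \<subseteq> lsupp K N" "N \<le> 0"
proof -
  from assms obtain K1 N1 K2 N2 where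
    *: "{c. f c \<noteq> 0} \<subseteq> lsupp K1 N1" "{c. g c \<noteq> 0} \<subseteq> lsupp K2 N2"
    unfolding is_laurent_def by blast
  let ?K = "max K1 K2" and ?N = "min 0 (min N1 N2)"
  show ?thesis
    by (rule that[of ?K ?N])
       (use * lsupp_mono[of K1 ?K ?N N1] lsupp_mono[of K2 ?K ?N N2] in \<open>auto simp: subset_iff\<close>)
qed

lemma is_laurent_common3:
  assumes "is_laurent f" "is_laurent g" "is_laurent h"
  obtains K N where "{c. f c \<noteq> 0} \<subseteq> lsupp K N" "{c. g c \<noteq> 0} \<subseteq> lsupp K N"
    "{c. h c \<noteq> 0} \<subseteq> lsupp K N" "N \<le> 0"
proof -
  obtain K1 N1 where *: "{c. f c \<noteq> 0} \<subseteq> lsupp K1 N1" "{c. g c \<noteq> 0} \<subseteq> lsupp K1 N1"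
    by (rule is_laurent_common[OF assms(1,2)])
  obtain K2 N2 where **: "{c. h c \<noteq> 0} \<subseteq> lsupp K2 N2"
    using assms(3) unfolding is_laurent_def by blast
  let ?K = "max K1 K2" and ?N = "min 0 (min N1 N2)"
  show ?thesis
    by (rule that[of ?K ?N])
       (use * ** lsupp_mono[of K1 ?K ?N N1] lsupp_mono[of K2 ?K ?N N2] in \<open>auto simp: subset_iff\<close>)
qed

definition conv :: "((nat \<Rightarrow>\<^sub>0 int) \<Rightarrow> rat) \<Rightarrow> ((nat \<Rightarrow>\<^sub>0 int) \<Rightarrow> rat) \<Rightarrow> (nat \<Rightarrow>\<^sub>0 int) \<Rightarrow> rat" where
  "conv f g c = Sum_any (\<lambda>a. f a * g (c - a))"

lemma conv_eq_sum:
  assumes "finite A" "\<And>a. f a \<noteq> 0 \<Longrightarrow> g (c - a) \<noteq> 0 \<Longrightarrow> a \<in> A"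
  shows "conv f g c = (\<Sum>a\<in>A. f a * g (c - a))"
  unfolding conv_def by (rule Sum_any.expand_superset) (use assms in auto)

lemma conv_nonzeroE:
  assumes "conv f g c \<noteq> 0"
  obtains a where "f a \<noteq> 0" "g (c - a) \<noteq> 0"
proof -
  from assms obtain a where "f a * g (c - a) \<noteq> 0"
    unfolding conv_def by (rule Sum_any.not_neutral_obtains_not_neutral)
  thus ?thesis using that[of a] by auto
qed

lemma is_laurent_zero: "is_laurent (\<lambda>_. 0)"
  by (auto simp: is_laurent_def)

lemma is_laurent_minus: "is_laurent f \<Longrightarrow> is_laurent (\<lambda>c. - f c)"
  by (simp add: is_laurent_def)

lemma is_laurent_add:
  assumes "is_laurent f" "is_laurent g"
  shows "is_laurent (\<lambda>c. f c + g c)"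
proof -
  obtain K N where "{c. f c \<noteq> 0} \<subseteq> lsupp K N" "{c. g c \<noteq> 0} \<subseteq> lsupp K N"
    by (rule is_laurent_common[OF assms])
  hence "{c. f c + g c \<noteq> 0} \<subseteq> lsupp K N" by force
  thus ?thesis unfolding is_laurent_def by blast
qed

lemma conv_supp:
  assumes "{c. f c \<noteq> 0} \<subseteq> lsupp K N" "{c. g c \<noteq> 0} \<subseteq> lsupp K N'"
  shows "{c. conv f g c \<noteq> 0} \<subseteq> lsupp K (N + N')"
proof safe
  fix c assume "conv f g c \<noteq> 0"
  then obtain a where "f a \<noteq> 0" "g (c - a) \<noteq> 0" by (rule conv_nonzeroE)
  hence "a + (c - a) \<in> lsupp K (N + N')"
    using assms by (intro lsupp_add) auto
  thus "c \<in> lsupp K (N + N')" by simp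
qed

lemma is_laurent_conv:
  assumes "is_laurent f" "is_laurent g"
  shows "is_laurent (conv f g)"
proof -
  obtain K N where "{c. f c \<noteq> 0} \<subseteq> lsupp K N" "{c. g c \<noteq> 0} \<subseteq> lsupp K N"
    by (rule is_laurent_common[OF assms])
  from conv_supp[OF this] show ?thesis unfolding is_laurent_def by blast
qed

lemma is_laurent_finite:
  assumes "finite {c. f c \<noteq> 0}"
  shows "is_laurent f"
proof -
  have "\<exists>K N. A \<subseteq> lsupp K N \<and> N \<le> 0" if "finite A" for A
    using that
  proof induction
    case empty
    show ?case by auto
  next
    case (insert c A)
    then obtain K N where A: "A \<subseteq> lsupp K N" "N \<le> 0" by blast
    define K1 where "K1 = Suc (Max (insert 0 (Poly_Mapping.keys c)))"
    define N1 where "N1 = - (\<Sum>j<K1. \<bar>Poly_Mapping.lookup c j\<bar>)"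
    have "c \<in> lsupp K1 N1"
    proof -
      have "Poly_Mapping.lookup c i = 0" if "i \<ge> K1" for i
      proof (rule ccontr)
        assume "Poly_Mapping.lookup c i \<noteq> 0"
        hence "i \<le> Max (insert 0 (Poly_Mapping.keys c))"
          by (intro Max_ge) (auto simp: in_keys_iff)
        thus False using that by (simp add: K1_def)
      qed
      moreover have "N1 \<le> (\<Sum>j=i..<K1. Poly_Mapping.lookup c j)" for i
      proof -
        have "\<bar>\<Sum>j=i..<K1. Poly_Mapping.lookup c j\<bar> \<le> (\<Sum>j=i..<K1. \<bar>Poly_Mapping.lookup c j\<bar>)"
          by (rule sum_abs)
        also have "\<dots> \<le> (\<Sum>j<K1. \<bar>Poly_Mapping.lookup c j\<bar>)"
          by (rule sum_mono2) auto
        finally show ?thesis by (simp add: N1_def)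
      qed
      ultimately show ?thesis by (simp add: lsupp_def)
    qed
    hence "insert c A \<subseteq> lsupp (max K K1) (min N N1)"
      using A lsupp_mono[of K "max K K1" "min N N1" N]
        lsupp_mono[of K1 "max K K1" "min N N1" N1] by auto
    moreover have "min N N1 \<le> 0" using A by auto
    ultimately show ?case by blast
  qed
  thus ?thesis using assms unfolding is_laurent_def by blast
qed

lemma conv_commute: "conv f g = conv g f"
proof
  fix c :: "nat \<Rightarrow>\<^sub>0 int"
  have "bij (\<lambda>a. c - a)"
    by (rule bij_betw_byWitness[where f' = "\<lambda>a. c - a"]) auto
  hence "conv g f c = Sum_any (\<lambda>a. f a * g (c - a))"
    unfolding conv_def by (rule Sum_any.reindex_cong) (auto simp: o_def mult.commute)
  thus "conv f g c = conv g f c" by (simp add: conv_def)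
qed

lemma conv_assoc:
  assumes "is_laurent f" "is_laurent g" "is_laurent h"
  shows "conv (conv f g) h = conv f (conv g h)"
proof
  fix c
  obtain K N where
    f: "{c. f c \<noteq> 0} \<subseteq> lsupp K N" and g: "{c. g c \<noteq> 0} \<subseteq> lsupp K N" and
    h: "{c. h c \<noteq> 0} \<subseteq> lsupp K N" and N: "N \<le> 0"
    by (rule is_laurent_common3[OF assms])
  define A where "A = {a. a \<in> lsupp K (N + N) \<and> c - a \<in> lsupp K (N + N)}"
  have A: "finite A" unfolding A_def by (rule finite_lsupp_diff)
  have mono: "a \<in> lsupp K (N + N)" if "a \<in> lsupp K N" for a
    using that lsupp_mono[of K K "N + N" N] N by auto
  have fg: "{c. conv f g c \<noteq> 0} \<subseteq> lsupp K (N + N)" by (rule conv_supp[OF f g])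
  have gh: "{c. conv g h c \<noteq> 0} \<subseteq> lsupp K (N + N)" by (rule conv_supp[OF g h])
  have mem: "a \<in> A" "s \<in> A" if "f a \<noteq> 0" "g (s - a) \<noteq> 0" "h (c - s) \<noteq> 0" for a s
  proof -
    have *: "a \<in> lsupp K N" "s - a \<in> lsupp K N" "c - s \<in> lsupp K N"
      using that f g h by auto
    have "c - a \<in> lsupp K (N + N)" using lsupp_add[OF *(2,3)] by simp
    thus "a \<in> A" using * mono by (simp add: A_def)
    have "s \<in> lsupp K (N + N)" using lsupp_add[OF *(1,2)] by simp
    thus "s \<in> A" using * mono by (simp add: A_def)
  qed
  have "conv (conv f g) h c = (\<Sum>s\<in>A. conv f g s * h (c - s))"
    by (rule conv_eq_sum[OF A]) (use fg h mono in \<open>auto simp: A_def\<close>)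
  also have "\<dots> = (\<Sum>s\<in>A. \<Sum>a\<in>A. f a * g (s - a) * h (c - s))"
  proof (rule sum.cong[OF refl])
    fix s assume "s \<in> A"
    show "conv f g s * h (c - s) = (\<Sum>a\<in>A. f a * g (s - a) * h (c - s))"
    proof (cases "h (c - s) = 0")
      case False
      hence "conv f g s = (\<Sum>a\<in>A. f a * g (s - a))"
        by (intro conv_eq_sum[OF A]) (use mem in auto)
      thus ?thesis by (simp add: sum_distrib_right)
    qed auto
  qed
  also have "\<dots> = (\<Sum>a\<in>A. \<Sum>s\<in>A. f a * g (s - a) * h (c - s))"
    by (rule sum.swap)
  also have "\<dots> = (\<Sum>a\<in>A. f a * conv g h (c - a))"
  proof (rule sum.cong[OF refl])
    fix a assume "a \<in> A"
    show "(\<Sum>s\<in>A. f a * g (s - a) * h (c - s)) = f a * conv g h (c - a)"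
    proof (cases "f a = 0")
      case False
      have "conv g h (c - a) = (\<Sum>b\<in>(\<lambda>s. s - a) ` A. g b * h (c - a - b))"
      proof (rule conv_eq_sum)
        fix b assume b: "g b \<noteq> 0" "h (c - a - b) \<noteq> 0"
        have "b + a \<in> A"
          by (rule mem(2)[of a]) (use False b in \<open>auto simp: algebra_simps\<close>)
        thus "b \<in> (\<lambda>s. s - a) ` A" by (auto intro!: image_eqI[of _ _ "b + a"])
      qed (use A in auto)
      also have "\<dots> = (\<Sum>s\<in>A. g (s - a) * h (c - s))"
        by (subst sum.reindex) (auto simp: inj_on_def)
      finally show ?thesis by (simp add: sum_distrib_left mult.assoc)
    qed auto
  qed
  also have "\<dots> = conv f (conv g h) c"
    by (rule conv_eq_sum[OF A, symmetric]) (use f gh mono in \<open>auto simp: A_def\<close>)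
  finally show "conv (conv f g) h c = conv f (conv g h) c" .
qed

typedef laurent = "{f. is_laurent f}"
  morphisms lcoeff Abs_laurent
  using is_laurent_zero by blast

lemma is_laurent_lcoeff [simp]: "is_laurent (lcoeff F)"
  using lcoeff[of F] by simp

lemma lcoeff_Abs_laurent [simp]: "is_laurent f \<Longrightarrow> lcoeff (Abs_laurent f) = f"
  by (simp add: Abs_laurent_inverse)

lemma laurent_eqI: "(\<And>c. lcoeff F c = lcoeff G c) \<Longrightarrow> F = G"
  by (metis lcoeff_inject ext)

lemma is_laurent_one: "is_laurent (\<lambda>c. if c = 0 then 1 else 0)"
  by (rule is_laurent_finite) auto

lemma conv_one: "conv (\<lambda>c. if c = 0 then 1 else 0) f = f"
proof
  fix c
  have "conv (\<lambda>c. if c = 0 then 1 else 0) f c = (\<Sum>a\<in>{0}. (if a = 0 then 1 else 0) * f (c - a))"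
    by (rule conv_eq_sum) (auto split: if_splits)
  thus "conv (\<lambda>c. if c = 0 then 1 else 0) f c = f c" by simp
qed

lemma conv_add:
  assumes "is_laurent f" "is_laurent g" "is_laurent h"
  shows "conv (\<lambda>c. f c + g c) h = (\<lambda>c. conv f h c + conv g h c)"
proof
  fix c
  obtain K N where
    f: "{c. f c \<noteq> 0} \<subseteq> lsupp K N" and g: "{c. g c \<noteq> 0} \<subseteq> lsupp K N" and
    h: "{c. h c \<noteq> 0} \<subseteq> lsupp K N"
    by (rule is_laurent_common3[OF assms])
  define A where "A = {a. a \<in> lsupp K N \<and> c - a \<in> lsupp K N}"
  have A: "finite A" unfolding A_def by (rule finite_lsupp_diff)
  have "conv (\<lambda>c. f c + g c) h c = (\<Sum>a\<in>A. (f a + g a) * h (c - a))"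
  proof (rule conv_eq_sum[OF A])
    fix a assume *: "f a + g a \<noteq> 0" "h (c - a) \<noteq> 0"
    hence "f a \<noteq> 0 \<or> g a \<noteq> 0" by auto
    hence "a \<in> lsupp K N" using f g by blast
    thus "a \<in> A" using * f g h by (auto simp: A_def)
  qed
  moreover have "conv f h c = (\<Sum>a\<in>A. f a * h (c - a))"
    by (rule conv_eq_sum[OF A]) (use f g h in \<open>auto simp: A_def\<close>)
  moreover have "conv g h c = (\<Sum>a\<in>A. g a * h (c - a))"
    by (rule conv_eq_sum[OF A]) (use f g h in \<open>auto simp: A_def\<close>)
  ultimately show "conv (\<lambda>c. f c + g c) h c = conv f h c + conv g h c"
    by (simp add: sum.distrib distrib_right)
qed

instantiation laurent :: comm_ring_1
begin

definition "0 = Abs_laurent (\<lambda>_. 0)"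
definition "1 = Abs_laurent (\<lambda>c. if c = 0 then 1 else 0)"
definition "F + G = Abs_laurent (\<lambda>c. lcoeff F c + lcoeff G c)"
definition "- F = Abs_laurent (\<lambda>c. - lcoeff F c)"
definition "(F :: laurent) - G = F + - G"
definition "F * G = Abs_laurent (conv (lcoeff F) (lcoeff G))"

lemma lcoeff_0 [simp]: "lcoeff 0 c = 0"
  by (simp add: zero_laurent_def is_laurent_zero)

lemma lcoeff_1: "lcoeff 1 = (\<lambda>c. if c = 0 then 1 else 0)"
  by (simp add: one_laurent_def is_laurent_one)

lemma lcoeff_add [simp]: "lcoeff (F + G) c = lcoeff F c + lcoeff G c"
  by (simp add: plus_laurent_def is_laurent_add)

lemma lcoeff_uminus [simp]: "lcoeff (- F) c = - lcoeff F c"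
  by (simp add: uminus_laurent_def is_laurent_minus)

lemma lcoeff_mult: "lcoeff (F * G) = conv (lcoeff F) (lcoeff G)"
  by (simp add: times_laurent_def is_laurent_conv)

instance
proof
  fix F G H :: laurent
  show "F * G * H = F * (G * H)"
    by (rule laurent_eqI) (simp add: lcoeff_mult conv_assoc)
  show "F * G = G * F"
    by (rule laurent_eqI) (simp add: lcoeff_mult conv_commute)
  show "1 * F = F"
    by (rule laurent_eqI) (simp add: lcoeff_mult lcoeff_1 conv_one)
  have "lcoeff (F + G) = (\<lambda>c. lcoeff F c + lcoeff G c)" by auto
  thus "(F + G) * H = F * H + G * H"
    by (intro laurent_eqI) (simp add: lcoeff_mult conv_add)
  have "lcoeff 0 0 \<noteq> lcoeff 1 0" by (simp add: lcoeff_1)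
  thus "(0 :: laurent) \<noteq> 1" by metis
qed (auto intro!: laurent_eqI simp: minus_laurent_def)

end


section \<open>Expansion and polynomial component\<close>

definition laurent_of_poly :: "mpoly \<Rightarrow> laurent" where
  "laurent_of_poly p = Abs_laurent (\<lambda>c.
     if \<forall>i. Poly_Mapping.lookup c i \<ge> 0 then Poly_Mapping.lookup p (Poly_Mapping.map nat c) else 0)"

lemma map_nat_int: "Poly_Mapping.map nat (Poly_Mapping.map int m) = m"
  by (rule poly_mapping_eqI) (simp add: Poly_Mapping.map.rep_eq when_def)

lemma map_int_nat:
  assumes "\<forall>i. Poly_Mapping.lookup c i \<ge> 0"
  shows "Poly_Mapping.map int (Poly_Mapping.map nat c) = c"
proof (rule poly_mapping_eqI)
  fix i
  have "Poly_Mapping.lookup c i \<ge> 0" using assms by blast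
  thus "Poly_Mapping.lookup (Poly_Mapping.map int (Poly_Mapping.map nat c)) i = Poly_Mapping.lookup c i"
    by (auto simp: Poly_Mapping.map.rep_eq when_def)
qed

lemma lcoeff_laurent_of_poly:
  "lcoeff (laurent_of_poly p) c =
     (if \<forall>i. Poly_Mapping.lookup c i \<ge> 0 then Poly_Mapping.lookup p (Poly_Mapping.map nat c) else 0)"
proof -
  let ?f = "\<lambda>c. if \<forall>i. Poly_Mapping.lookup c i \<ge> 0
                 then Poly_Mapping.lookup p (Poly_Mapping.map nat c) else 0"
  have "{c. ?f c \<noteq> 0} \<subseteq> Poly_Mapping.map int ` Poly_Mapping.keys p"
  proof safe
    fix c assume "?f c \<noteq> 0"
    thus "c \<in> Poly_Mapping.map int ` Poly_Mapping.keys p"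
      by (intro image_eqI[of _ _ "Poly_Mapping.map nat c"])
         (auto simp: map_int_nat in_keys_iff split: if_splits)
  qed
  hence "finite {c. ?f c \<noteq> 0}" by (rule finite_subset) auto
  hence "is_laurent ?f" by (rule is_laurent_finite)
  thus ?thesis by (simp add: laurent_of_poly_def)
qed

text \<open>
  The series \<open>\<Sum>r. (-1)^r * x j ^ r * x i powi (-1 - r)\<close>, which is a Laurent series for \<open>i < j\<close>.
\<close>

definition inv_exponent :: "nat \<Rightarrow> nat \<Rightarrow> nat \<Rightarrow> (nat \<Rightarrow>\<^sub>0 int)" where
  "inv_exponent i j r = Poly_Mapping.single j (int r) + Poly_Mapping.single i (- 1 - int r)"

definition inv_sum :: "nat \<Rightarrow> nat \<Rightarrow> laurent" where
  "inv_sum i j = Abs_laurent (\<lambda>c. Sum_any (\<lambda>r. if c = inv_exponent i j r then (- 1) ^ r else 0))"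

lemma lookup_inv_exponent:
  assumes "i < j"
  shows "Poly_Mapping.lookup (inv_exponent i j r) l =
           (if l = j then int r else if l = i then - 1 - int r else 0)"
  using assms by (auto simp: inv_exponent_def lookup_add lookup_single when_def)

lemma inv_exponent_inject:
  assumes "i < j"
  shows "inv_exponent i j r = inv_exponent i j s \<longleftrightarrow> r = s"
proof
  assume "inv_exponent i j r = inv_exponent i j s"
  hence "Poly_Mapping.lookup (inv_exponent i j r) j = Poly_Mapping.lookup (inv_exponent i j s) j"
    by (simp only:)
  thus "r = s" unfolding lookup_inv_exponent[OF assms] by simp
qed (simp only:)

lemma inv_exponent_lsupp:
  assumes "i < j"
  shows "inv_exponent i j r \<in> lsupp (Suc j) (- 1)"
proof -
  have "- 1 \<le> (\<Sum>l=t..<Suc j. Poly_Mapping.lookup (inv_exponent i j r) l)" for t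
  proof -
    have "(\<Sum>l=t..<Suc j. Poly_Mapping.lookup (inv_exponent i j r) l) =
          (\<Sum>l=t..<Suc j. (if l = j then int r else 0) + (if l = i then - 1 - int r else 0))"
      by (rule sum.cong) (use assms in \<open>auto simp: lookup_inv_exponent\<close>)
    also have "\<dots> = (if t \<le> j then int r else 0) + (if t \<le> i then - 1 - int r else 0)"
      unfolding sum.distrib by (subst (1 2) sum.delta) (use assms in auto)
    finally show ?thesis using assms by auto
  qed
  thus ?thesis using assms by (auto simp: lsupp_def lookup_inv_exponent)
qed

lemma lcoeff_inv_sum:
  assumes "i < j"
  shows "lcoeff (inv_sum i j) c = Sum_any (\<lambda>r. if c = inv_exponent i j r then (- 1) ^ r else 0)"
proof -
  let ?f = "\<lambda>c. Sum_any (\<lambda>r. if c = inv_exponent i j r then (- 1) ^ r else 0 :: rat)"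
  have "{c. ?f c \<noteq> 0} \<subseteq> lsupp (Suc j) (- 1)"
  proof safe
    fix c assume *: "?f c \<noteq> 0"
    have "\<exists>r. c = inv_exponent i j r"
    proof (rule ccontr)
      assume "\<not> ?thesis"
      hence "?f c = 0" by simp
      with * show False by simp
    qed
    thus "c \<in> lsupp (Suc j) (- 1)" using inv_exponent_lsupp[OF assms] by auto
  qed
  hence "is_laurent ?f" unfolding is_laurent_def by blast
  thus ?thesis by (simp add: inv_sum_def)
qed

lemma lcoeff_inv_sum_exponent:
  assumes "i < j"
  shows "lcoeff (inv_sum i j) (inv_exponent i j r) = (- 1) ^ r"
proof -
  have "lcoeff (inv_sum i j) (inv_exponent i j r) =
          Sum_any (\<lambda>s. if inv_exponent i j r = inv_exponent i j s then (- 1) ^ s else 0)"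
    by (rule lcoeff_inv_sum[OF assms])
  also have "\<dots> = Sum_any (\<lambda>s. if s = r then (- 1) ^ s else 0)"
    unfolding inv_exponent_inject[OF assms] by (rule Sum_any.cong) auto
  also have "\<dots> = (- 1) ^ r" by (rule Sum_any.delta)
  finally show ?thesis .
qed

lemma lcoeff_inv_sum_eq_0:
  assumes "i < j" "\<And>r. c \<noteq> inv_exponent i j r"
  shows "lcoeff (inv_sum i j) c = 0"
  unfolding lcoeff_inv_sum[OF assms(1)] by (simp add: assms(2))

lemma inv_sum_inverse:
  assumes "i < j"
  shows "laurent_of_poly (pvar i + pvar j) * inv_sum i j = 1"
proof (rule laurent_eqI)
  fix c :: "nat \<Rightarrow>\<^sub>0 int"
  define e :: "nat \<Rightarrow> nat \<Rightarrow>\<^sub>0 int" where "e = (\<lambda>i. Poly_Mapping.single i 1)"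
  let ?g = "lcoeff (inv_sum i j)" and ?f = "lcoeff (laurent_of_poly (pvar i + pvar j))"
  have neq: "e i \<noteq> e j"
  proof
    assume "e i = e j"
    hence "Poly_Mapping.lookup (e i) i = Poly_Mapping.lookup (e j) i" by simp
    thus False using assms by (simp add: e_def lookup_single when_def)
  qed
  have single: "(\<forall>l. Poly_Mapping.lookup a l \<ge> 0) \<and> Poly_Mapping.map nat a = Poly_Mapping.single t 1
                  \<longleftrightarrow> a = e t" for a t
  proof
    assume *: "(\<forall>l. Poly_Mapping.lookup a l \<ge> 0) \<and> Poly_Mapping.map nat a = Poly_Mapping.single t 1"
    hence "a = Poly_Mapping.map int (Poly_Mapping.single t 1)"
      using map_int_nat[of a] by simp
    thus "a = e t"
      by (auto simp: e_def intro!: poly_mapping_eqI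
            simp: Poly_Mapping.map.rep_eq lookup_single when_def)
  next
    assume "a = e t"
    thus "(\<forall>l. Poly_Mapping.lookup a l \<ge> 0) \<and> Poly_Mapping.map nat a = Poly_Mapping.single t 1"
      by (auto simp: e_def intro!: poly_mapping_eqI
            simp: Poly_Mapping.map.rep_eq lookup_single when_def)
  qed
  have f: "?f a = (if a = e i then 1 else 0) + (if a = e j then 1 else 0)" for a
    unfolding lcoeff_laurent_of_poly single[symmetric] pvar_def lookup_add lookup_single
    by (auto simp: when_def)
  have "conv ?f ?g c = (\<Sum>a\<in>{e i, e j}. ?f a * ?g (c - a))"
    by (rule conv_eq_sum) (auto simp: f split: if_splits)
  also have "\<dots> = ?g (c - e i) + ?g (c - e j)"
    using neq by (simp add: f)
  also have "\<dots> = (if c = 0 then 1 else 0)"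
  proof -
    define d where "d = (\<lambda>r. inv_exponent i j r + e i)"
    have d: "Poly_Mapping.lookup (d r) l = (if l = j then int r else if l = i then - int r else 0)" for r l
      using assms by (auto simp: d_def e_def lookup_add lookup_inv_exponent lookup_single when_def)
    have d0: "d 0 = 0" by (rule poly_mapping_eqI) (simp add: d)
    have dS: "inv_exponent i j r + e j = d (Suc r)" for r
      by (rule poly_mapping_eqI) (use assms in
          \<open>auto simp: d lookup_add lookup_inv_exponent e_def lookup_single when_def\<close>)
    have dinj: "r = s" if "d r = d s" for r s
    proof -
      have "Poly_Mapping.lookup (d r) j = Poly_Mapping.lookup (d s) j" by (simp only: that)
      thus ?thesis unfolding d by simp
    qed
    have di: "d r - e i = inv_exponent i j r" for r
      unfolding d_def by (rule add_diff_cancel_right')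
    have dj: "d (Suc r) - e j = inv_exponent i j r" for r
      unfolding dS[symmetric] by (rule add_diff_cancel_right')
    have gi: "?g (d r - e i) = (- 1) ^ r" for r
      unfolding di by (rule lcoeff_inv_sum_exponent[OF assms])
    have gj: "?g (d (Suc r) - e j) = (- 1) ^ r" for r
      unfolding dj by (rule lcoeff_inv_sum_exponent[OF assms])
    have gi0: "?g (c - e i) = 0" if "\<And>r. c \<noteq> d r"
    proof (rule lcoeff_inv_sum_eq_0[OF assms])
      fix r show "c - e i \<noteq> inv_exponent i j r"
        using that[of r] by (metis d_def diff_add_cancel)
    qed
    have gj0: "?g (c - e j) = 0" if "\<And>r. c \<noteq> d (Suc r)"
    proof (rule lcoeff_inv_sum_eq_0[OF assms])
      fix r show "c - e j \<noteq> inv_exponent i j r"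
        using that[of r] by (metis dS diff_add_cancel)
    qed
    show ?thesis
    proof (cases "\<exists>r. c = d r")
      case False
      thus ?thesis using gi0 gj0 d0 by auto
    next
      case True
      then obtain r where r: "c = d r" by blast
      show ?thesis
      proof (cases r)
        case 0
        have "?g (c - e j) = 0"
          by (rule gj0) (use r 0 dinj in blast)
        thus ?thesis using r 0 gi[of 0] d0 by simp
      next
        case (Suc s)
        have "c \<noteq> 0"
        proof
          assume "c = 0"
          hence "d r = d 0" using r d0 by simp
          from dinj[OF this] show False using Suc by simp
        qed
        thus ?thesis using r Suc gi[of r] gj[of s] by simp
      qed
    qed
  qed
  finally show "lcoeff (laurent_of_poly (pvar i + pvar j) * inv_sum i j) c = lcoeff 1 c"
    by (simp add: lcoeff_mult lcoeff_1)
qed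

definition expansion :: "nat \<Rightarrow> mratfun \<Rightarrow> laurent" where
  "expansion k f = laurent_of_poly (numerator k f) * (\<Prod>(i, j)\<in>pairs k. inv_sum i j)"

text \<open>
  The polynomial component is formed inside the Laurent series; polynomials are identified with
  Laurent series through \<open>laurent_of_poly\<close>.
\<close>

definition polynomial_component :: "nat \<Rightarrow> mratfun \<Rightarrow> laurent" where
  "polynomial_component k f = Abs_laurent (\<lambda>c.
     if \<forall>i. Poly_Mapping.lookup c i \<ge> 0 then lcoeff (expansion k f) c else 0)"

lemma lcoeff_polynomial_component:
  "lcoeff (polynomial_component k f) c =
     (if \<forall>i. Poly_Mapping.lookup c i \<ge> 0 then lcoeff (expansion k f) c else 0)"
proof -
  let ?f = "\<lambda>c. if \<forall>i. Poly_Mapping.lookup c i \<ge> 0 then lcoeff (expansion k f) c else 0"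
  obtain K N where "{c. lcoeff (expansion k f) c \<noteq> 0} \<subseteq> lsupp K N"
    using is_laurent_lcoeff[of "expansion k f"] unfolding is_laurent_def by blast
  hence "{c. ?f c \<noteq> 0} \<subseteq> lsupp K N" by auto
  hence "is_laurent ?f" unfolding is_laurent_def by blast
  thus ?thesis by (simp add: polynomial_component_def)
qed

end

theory Submission
  imports Defs "HOL-Computational_Algebra.Polynomial"
begin

text \<open>
  Write \<open>G\<^sub>S\<close> for the product of \<open>(x\<^sub>i - x\<^sub>j) / (x\<^sub>i + x\<^sub>j)\<close> over \<open>i < j\<close> in a finite set \<open>S\<close> of indices,
  and \<open>X\<^sub>S\<close> for the sum of the variables with index in \<open>S\<close>.  The proof rests on Schur's Pfaffian:
  \<open>G\<^sub>S\<close> is a signed sum over perfect matchings of \<open>S\<close> of products of the two-variable factors of the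
  matched pairs (with one variable left alone if \<open>S\<close> is odd).  For a product of functions in disjoint sets
  of variables the formula is multiplicative, so that only one and two variables remain to be checked.

  Multiplicativity (\<open>multinomial_component_union\<close>) holds because, by the Vandermonde convolution, the
  falling factorial of \<open>X\<^sub>U + X\<^sub>V\<close> splits into products of falling factorials of \<open>X\<^sub>U\<close> and of \<open>X\<^sub>V\<close>,
  because the polynomial component of a product of series in disjoint variables is the product of the
  polynomial components (\<open>nonneg_part_mult\<close>), and because the multinomial coefficients on the right-hand
  side split in the same way.

  For two variables and \<open>n > 0\<close>, the factor \<open>x + y\<close> of the falling factorial cancels the denominator, and what
  remains is the polynomial \<open>(x - y)\<close> times the falling factorial of \<open>x + y - 1\<close> with \<open>n - 1\<close> factors, expanded by
  Vandermonde (\<open>multinomial_component_ratio\<close>).  For \<open>n = 0\<close>, every term of the expansion of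
  \<open>(x - y) / (x + y)\<close> except the constant term 1 has a negative exponent; this is where the convention for
  \<open>m\<^sub>i = m\<^sub>j = 0\<close> comes from.

  The Pfaffian is used through its expansion along one index, so that matchings never appear.  This
  expansion has to hold twice: for the Laurent series \<open>G\<^sub>S\<close>, and for the numbers obtained by putting
  \<open>x\<^sub>i = m\<^sub>i\<close> with the convention for \<open>0 / 0\<close>.  Both are images of the same expansion in a field
  (\<open>pair_prod_ratio_odd\<close>, \<open>pair_prod_ratio_even\<close>), which follows from Lagrange interpolation.
  The series are obtained from rational functions by expansion.  The numbers are obtained from
  \<open>x\<^sub>i = m\<^sub>i + \<epsilon>\<^bsup>i+1\<^esup>\<close> by letting \<open>\<epsilon>\<close> be zero: for \<open>i < j\<close> and \<open>m\<^sub>i = m\<^sub>j = 0\<close> the quotient becomes 1 as required.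
  The notion covering both is that of a fraction specializing along a ring homomorphism.
\<close>

section \<open>Products over increasing pairs\<close>

definition pair_prod :: "(nat \<Rightarrow> nat \<Rightarrow> 'a::comm_ring_1) \<Rightarrow> nat set \<Rightarrow> 'a" where
  "pair_prod a S = (\<Prod>(i, j)\<in>{(i, j). i \<in> S \<and> j \<in> S \<and> i < j}. a i j)"

lemma pair_prod_empty [simp]: "pair_prod a {} = 1"
  by (simp add: pair_prod_def)

lemma finite_increasing_pairs:
  assumes "finite (S :: nat set)"
  shows "finite {(i, j). i \<in> S \<and> j \<in> S \<and> i < j}"
  by (rule finite_subset[of _ "S \<times> S"]) (use assms in auto)

lemma pair_prod_remove:
  assumes "finite S" "j \<in> S"
  shows "pair_prod a S = pair_prod a (S - {j}) * (\<Prod>i\<in>S - {j}. if i < j then a i j else a j i)"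
proof -
  let ?P = "\<lambda>S. {(i, j). i \<in> S \<and> j \<in> S \<and> i < j}" and ?f = "\<lambda>i. if i < j then (i, j) else (j, i)"
  have eq: "?P S = ?P (S - {j}) \<union> ?f ` (S - {j})"
    using assms by (auto simp: image_iff)
  have inj: "inj_on ?f (S - {j})"
    by (auto simp: inj_on_def split: if_splits)
  have disj: "?P (S - {j}) \<inter> ?f ` (S - {j}) = {}"
    by (auto split: if_splits)
  have "pair_prod a S = (\<Prod>(i, j)\<in>?P (S - {j}) \<union> ?f ` (S - {j}). a i j)"
    by (simp only: pair_prod_def eq)
  also have "\<dots> = (\<Prod>(i, j)\<in>?P (S - {j}). a i j) * (\<Prod>(i, j)\<in>?f ` (S - {j}). a i j)"
    by (rule prod.union_disjoint[OF finite_increasing_pairs _ disj]) (use assms in simp_all)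
  also have "(\<Prod>(i, j)\<in>?f ` (S - {j}). a i j) = (\<Prod>i\<in>S - {j}. if i < j then a i j else a j i)"
    unfolding prod.reindex[OF inj] by (rule prod.cong) auto
  finally show ?thesis by (simp add: pair_prod_def)
qed

lemma pair_prod_remove_Min:
  assumes "finite S" "S \<noteq> {}"
  shows "pair_prod a S = pair_prod a (S - {Min S}) * (\<Prod>i\<in>S - {Min S}. a (Min S) i)"
proof -
  have "(\<Prod>i\<in>S - {Min S}. if i < Min S then a i (Min S) else a (Min S) i) = (\<Prod>i\<in>S - {Min S}. a (Min S) i)"
  proof (rule prod.cong[OF refl])
    fix i assume "i \<in> S - {Min S}"
    hence "Min S \<le> i" using assms(1) by simp
    thus "(if i < Min S then a i (Min S) else a (Min S) i) = a (Min S) i" by simp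
  qed
  thus ?thesis using pair_prod_remove[of S "Min S" a] assms by simp
qed

section \<open>A rational identity from Lagrange interpolation\<close>

lemma degree_prod_linear:
  "finite A \<Longrightarrow> degree (\<Prod>b\<in>A. [:f b, 1 :: 'a::idom:]) = card A"
  by (subst degree_prod_eq_sum_degree) auto

lemma coeff_prod_linear:
  assumes "finite A"
  shows "coeff (\<Prod>b\<in>A. [:f b, 1 :: 'a::idom:]) (card A) = 1"
proof -
  have "lead_coeff (\<Prod>b\<in>A. [:f b, 1 :: 'a:]) = 1"
    by (simp add: lead_coeff_prod)
  thus ?thesis by (simp add: degree_prod_linear[OF assms])
qed

text \<open>
  Lagrange's interpolation formula for the values of \<open>p\<close> on \<open>A\<close> gives back \<open>p\<close>, and its basis polynomials
  have degree \<open>card A - 1\<close>; compare the coefficients of this degree.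
\<close>

lemma lagrange_leading_coefficient:
  fixes A :: "'a::field set"
  assumes "finite A" "degree p < card A"
  shows "(\<Sum>a\<in>A. poly p a / (\<Prod>b\<in>A - {a}. a - b)) = coeff p (card A - 1)"
proof -
  let ?c = "\<lambda>a. poly p a / (\<Prod>b\<in>A - {a}. a - b)"
  define q where "q = (\<Sum>a\<in>A. smult (?c a) (\<Prod>b\<in>A - {a}. [:- b, 1:]))"
  have card: "card (A - {a}) = card A - 1" if "a \<in> A" for a
    using that assms by simp
  have "poly q x = poly p x" if x: "x \<in> A" for x
  proof -
    have "poly q x = (\<Sum>a\<in>A. ?c a * (\<Prod>b\<in>A - {a}. x - b))"
      by (simp add: q_def poly_sum poly_prod)
    also have "\<dots> = (\<Sum>a\<in>{x}. ?c a * (\<Prod>b\<in>A - {a}. x - b))"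
      by (rule sum.mono_neutral_right) (use assms x in \<open>auto simp: prod_zero_iff\<close>)
    also have "\<dots> = poly p x"
      using assms by (simp add: prod_zero_iff)
    finally show ?thesis .
  qed
  moreover have "degree q \<le> card A - 1"
    unfolding q_def
    by (rule degree_sum_le[OF assms(1)])
       (use assms in \<open>auto intro!: order_trans[OF degree_smult_le] simp: degree_prod_linear card\<close>)
  ultimately have "p = q"
    using assms by (intro poly_eqI_degree[of A]) auto
  hence "coeff p (card A - 1) = (\<Sum>a\<in>A. ?c a * coeff (\<Prod>b\<in>A - {a}. [:- b, 1:]) (card A - 1))"
    by (subst (1) \<open>p = q\<close>, subst q_def) (simp add: coeff_sum)
  also have "\<dots> = (\<Sum>a\<in>A. ?c a)"
  proof (rule sum.cong[OF refl])
    fix a assume "a \<in> A"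
    thus "?c a * coeff (\<Prod>b\<in>A - {a}. [:- b, 1:]) (card A - 1) = ?c a"
      using assms(1) coeff_prod_linear[of "A - {a}" uminus] by (simp only: card finite_Diff mult_1_right)
  qed
  finally show ?thesis by simp
qed

text \<open>
  Lagrange interpolation of \<open>p = \<Prod>b\<in>A. (X + b)\<close> at the points of \<open>A\<close> and the additional node 0.  The
  term of \<open>a \<in> A\<close> is twice the product on the left, since the factor \<open>a + a\<close> of \<open>p\<close> meets the factor \<open>a - 0\<close>
  of the denominator; the term of the node 0 is a sign, and so the parity of \<open>A\<close> matters.
\<close>

lemma sum_prod_ratio:
  fixes A :: "'a::field set"
  assumes "finite A" "0 \<notin> A" "(2 :: 'a) \<noteq> 0"
  shows "(\<Sum>a\<in>A. \<Prod>b\<in>A - {a}. (a + b) / (a - b)) = (if odd (card A) then 1 else 0)"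
proof -
  define p where "p = (\<Prod>b\<in>A. [:b, 1:])"
  let ?d = "\<lambda>a. \<Prod>b\<in>insert 0 A - {a}. a - b"
  have "1 = (\<Sum>a\<in>insert 0 A. poly p a / ?d a)"
    using assms lagrange_leading_coefficient[of "insert 0 A" p]
    by (simp add: p_def degree_prod_linear coeff_prod_linear)
  also have "\<dots> = poly p 0 / ?d 0 + (\<Sum>a\<in>A. poly p a / ?d a)"
    using assms by simp
  also have "poly p 0 / ?d 0 = (-1) ^ card A"
  proof -
    have "?d 0 = (\<Prod>b\<in>A. (-1) * b)" using assms by (intro prod.cong) auto
    also have "\<dots> = (-1) ^ card A * poly p 0"
      by (subst prod.distrib) (simp add: p_def poly_prod)
    finally have "?d 0 = (-1) ^ card A * poly p 0" .
    moreover have "poly p 0 \<noteq> 0"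
      using assms by (simp add: p_def poly_prod prod_zero_iff)
    ultimately show ?thesis
      by (cases "even (card A)") (simp_all only: minus_one_power_iff, simp_all)
  qed
  also have "(\<Sum>a\<in>A. poly p a / ?d a) = (\<Sum>a\<in>A. 2 * (\<Prod>b\<in>A - {a}. (a + b) / (a - b)))"
  proof (rule sum.cong[OF refl])
    fix a assume a: "a \<in> A"
    have "insert 0 A - {a} = insert 0 (A - {a})" using a assms by auto
    hence "?d a = a * (\<Prod>b\<in>A - {a}. a - b)" using assms by simp
    moreover have "poly p a = 2 * a * (\<Prod>b\<in>A - {a}. a + b)"
      unfolding p_def poly_prod using assms a by (subst prod.remove[OF _ a]) (auto simp: add.commute)
    moreover have "a \<noteq> 0" using a assms by auto
    ultimately show "poly p a / ?d a = 2 * (\<Prod>b\<in>A - {a}. (a + b) / (a - b))"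
      by (simp add: prod_dividef)
  qed
  finally have "2 * (\<Sum>a\<in>A. \<Prod>b\<in>A - {a}. (a + b) / (a - b)) = 1 - (-1) ^ card A"
    by (simp add: sum_distrib_left algebra_simps)
  also have "\<dots> = 2 * (if odd (card A) then 1 else 0)" by simp
  finally show ?thesis using assms(3) by (simp only: mult_cancel_left) auto
qed

lemma sum_prod_ratio_indexed:
  fixes x :: "'i \<Rightarrow> 'a::field"
  assumes "finite S" "inj_on x S" "\<forall>i\<in>S. x i \<noteq> 0" "(2 :: 'a) \<noteq> 0"
  shows "(\<Sum>j\<in>S. \<Prod>i\<in>S - {j}. (x j + x i) / (x j - x i)) = (if odd (card S) then 1 else 0)"
proof -
  have "(\<Sum>a\<in>x ` S. \<Prod>b\<in>x ` S - {a}. (a + b) / (a - b)) =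
        (\<Sum>j\<in>S. \<Prod>b\<in>x ` S - {x j}. (x j + b) / (x j - b))"
    by (simp add: sum.reindex[OF assms(2)])
  also have "\<dots> = (\<Sum>j\<in>S. \<Prod>i\<in>S - {j}. (x j + x i) / (x j - x i))"
  proof (rule sum.cong[OF refl])
    fix j assume "j \<in> S"
    hence "x ` S - {x j} = x ` (S - {j})" using assms(2) by (auto simp: inj_on_def)
    moreover have "inj_on x (S - {j})" using assms(2) by (rule inj_on_subset) auto
    ultimately show "(\<Prod>b\<in>x ` S - {x j}. (x j + b) / (x j - b)) = (\<Prod>i\<in>S - {j}. (x j + x i) / (x j - x i))"
      by (simp add: prod.reindex)
  qed
  finally show ?thesis
    using sum_prod_ratio[of "x ` S"] assms by (auto simp: card_image image_iff)
qed

section \<open>Expanding the pair product of a field along an index\<close>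

text \<open>
  The factors with index \<open>j\<close> cancel against the product on the left up to one sign for each
  \<open>i < j\<close>, where the ratio is oriented as \<open>(x i - x j) / (x i + x j)\<close>.
\<close>

lemma pair_prod_ratio_remove:
  fixes x :: "nat \<Rightarrow> 'a::field"
  assumes "finite S" "j \<in> S" "inj_on x S" "\<And>i j. i \<in> S \<Longrightarrow> j \<in> S \<Longrightarrow> x i + x j \<noteq> 0"
  defines "r \<equiv> \<lambda>i j. (x i - x j) / (x i + x j)"
  shows "pair_prod r S * (\<Prod>i\<in>S - {j}. (x j + x i) / (x j - x i)) =
           (-1) ^ card {i \<in> S. i < j} * pair_prod r (S - {j})"
proof -
  have "(\<Prod>i\<in>S - {j}. if i < j then r i j else r j i) * (\<Prod>i\<in>S - {j}. (x j + x i) / (x j - x i)) =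
        (\<Prod>i\<in>S - {j}. (if i < j then r i j else r j i) * ((x j + x i) / (x j - x i)))"
    by (simp only: prod.distrib)
  also have "\<dots> = (\<Prod>i\<in>S - {j}. if i < j then -1 else 1)"
  proof (rule prod.cong[OF refl])
    fix i assume i: "i \<in> S - {j}"
    have "x j + x i \<noteq> 0" using i assms by auto
    moreover have "x j - x i \<noteq> 0" using i assms(2,3) by (auto simp: inj_on_def)
    moreover have "(x i - x j) / (x j - x i) = - 1"
      using \<open>x j - x i \<noteq> 0\<close> by (simp add: divide_eq_minus_1_iff)
    ultimately show "(if i < j then r i j else r j i) * ((x j + x i) / (x j - x i)) = (if i < j then -1 else 1)"
      unfolding r_def add.commute[of "x i" "x j"] by simp
  qed
  also have "\<dots> = (\<Prod>i\<in>{i \<in> S. i < j}. -1)"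
  proof -
    have "(S - {j}) \<inter> {i. i < j} = {i \<in> S. i < j}" by auto
    thus ?thesis using assms(1) by (simp add: prod.If_cases)
  qed
  also have "\<dots> = (-1) ^ card {i \<in> S. i < j}" by simp
  finally show ?thesis
    unfolding pair_prod_remove[OF assms(1,2)] by (simp add: mult_ac)
qed

text \<open>
  The expansion of the Pfaffian of an odd set, in which the index that is left alone is \<open>j\<close>: it is the
  identity \<open>sum_prod_ratio_indexed\<close> multiplied by the pair product.
\<close>

lemma pair_prod_ratio_odd:
  fixes x :: "nat \<Rightarrow> 'a::field"
  assumes "finite S" "inj_on x S" "\<And>i j. i \<in> S \<Longrightarrow> j \<in> S \<Longrightarrow> x i + x j \<noteq> 0" "odd (card S)"
  defines "r \<equiv> \<lambda>i j. (x i - x j) / (x i + x j)"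
  shows "pair_prod r S = (\<Sum>j\<in>S. (-1) ^ card {i \<in> S. i < j} * pair_prod r (S - {j}))"
proof -
  have nz: "2 * x i \<noteq> 0" if "i \<in> S" for i using assms(3)[OF that that] by simp
  moreover obtain s where "s \<in> S" using assms(4) by fastforce
  ultimately have "(2 :: 'a) \<noteq> 0" by force
  moreover have "\<forall>i\<in>S. x i \<noteq> 0" using nz by auto
  ultimately have "pair_prod r S = pair_prod r S * (\<Sum>j\<in>S. \<Prod>i\<in>S - {j}. (x j + x i) / (x j - x i))"
    using assms(1,2,4) by (subst sum_prod_ratio_indexed) auto
  also have "\<dots> = (\<Sum>j\<in>S. (-1) ^ card {i \<in> S. i < j} * pair_prod r (S - {j}))"
    unfolding sum_distrib_left r_def
    by (rule sum.cong[OF refl], rule pair_prod_ratio_remove) (use assms in auto)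
  finally show ?thesis .
qed

text \<open>
  The expansion of the Pfaffian of an even set along its least index \<open>s\<close>, which is matched with \<open>j\<close>.  It
  results from \<open>sum_prod_ratio_indexed\<close> when \<open>x s\<close> is replaced by its negative: this turns the
  factors \<open>(x j + x s) / (x j - x s)\<close> upside down, which is how the ratios themselves
  enter.  The sum is 0 because the set is even, and solving for the term of \<open>s\<close> gives the expansion.
\<close>

lemma pair_prod_ratio_even:
  fixes x :: "nat \<Rightarrow> 'a::field"
  assumes "finite S" "inj_on x S" "\<And>i j. i \<in> S \<Longrightarrow> j \<in> S \<Longrightarrow> x i + x j \<noteq> 0" "even (card S)" "S \<noteq> {}"
  defines "r \<equiv> \<lambda>i j. (x i - x j) / (x i + x j)" and "T \<equiv> S - {Min S}"
  shows "pair_prod r S = (\<Sum>j\<in>T. (-1) ^ card {i \<in> T. i < j} * r (Min S) j * pair_prod r (T - {j}))"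
proof -
  define s where "s = Min S"
  have s: "s \<in> S" using assms by (simp add: s_def)
  have T1: "T = S - {s}"
    by (simp only: T_def s_def)
  have T: "T = S - {s}" "finite T" "inj_on x T"
    unfolding T1 using assms(1) inj_on_diff[OF assms(2)] by blast+
  have nz: "2 * x i \<noteq> 0" if "i \<in> S" for i using assms(3)[OF that that] by simp
  hence two: "(2 :: 'a) \<noteq> 0" using s by force
  define y where "y = x(s := - x s)"
  have yT: "y i = x i" if "i \<in> T" for i using that T by (auto simp: y_def)
  have ys: "y s = - x s" by (simp add: y_def)
  have "inj_on y S"
  proof -
    have "x i \<noteq> - x s" if "i \<in> T" for i using assms(3)[of i s] that T(1) s by (auto simp: eq_neg_iff_add_eq_0)
    hence "y s \<notin> y ` T" unfolding ys image_iff by (metis yT)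
    moreover have "inj_on y T" using T(3) by (simp add: inj_on_def yT)
    moreover have "T - {s} = T" using T1 by blast
    ultimately have "inj_on y (insert s T)" by (simp only: inj_on_insert) blast
    thus ?thesis using T(1) s by (simp add: insert_absorb)
  qed
  moreover have "\<forall>i\<in>S. y i \<noteq> 0" using nz by (auto simp: y_def)
  ultimately have "(\<Sum>j\<in>S. \<Prod>i\<in>S - {j}. (y j + y i) / (y j - y i)) = 0"
    using assms(1,4) two by (subst sum_prod_ratio_indexed) auto
  hence "(\<Prod>i\<in>T. (y s + y i) / (y s - y i)) + (\<Sum>j\<in>T. \<Prod>i\<in>S - {j}. (y j + y i) / (y j - y i)) = 0"
    using sum.remove[OF assms(1) s, of "\<lambda>j. \<Prod>i\<in>S - {j}. (y j + y i) / (y j - y i)"] T(1) by simp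
  moreover have "(\<Prod>i\<in>T. (y s + y i) / (y s - y i)) = (\<Prod>i\<in>T. r s i)"
  proof (rule prod.cong[OF refl])
    fix i assume i: "i \<in> T"
    have "y s + y i = - (x s - x i)" "y s - y i = - (x s + x i)" by (simp_all add: ys yT i)
    thus "(y s + y i) / (y s - y i) = r s i" by (simp only: minus_divide_divide r_def)
  qed
  moreover have "(\<Prod>i\<in>S - {j}. (y j + y i) / (y j - y i)) = - (r s j * (\<Prod>i\<in>T - {j}. (x j + x i) / (x j - x i)))"
    if j: "j \<in> T" for j
  proof -
    have "S - {j} = insert s (T - {j})" using j T s by auto
    hence "(\<Prod>i\<in>S - {j}. (y j + y i) / (y j - y i)) =
            ((y j + y s) / (y j - y s)) * (\<Prod>i\<in>T - {j}. (y j + y i) / (y j - y i))"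
      using T by simp
    also have "(y j + y s) / (y j - y s) = - r s j"
      unfolding ys yT[OF j] r_def minus_divide_left by (rule arg_cong2[of _ _ _ _ "(/)"]) simp_all
    also have "(\<Prod>i\<in>T - {j}. (y j + y i) / (y j - y i)) = (\<Prod>i\<in>T - {j}. (x j + x i) / (x j - x i))"
      by (rule prod.cong) (auto simp: yT j)
    finally show ?thesis by simp
  qed
  ultimately have *: "(\<Prod>i\<in>T. r s i) = (\<Sum>j\<in>T. r s j * (\<Prod>i\<in>T - {j}. (x j + x i) / (x j - x i)))"
    by (simp add: sum_negf)
  have "pair_prod r S = pair_prod r T * (\<Prod>i\<in>T. r s i)"
    using pair_prod_remove_Min[of S r] assms(1,5) by (simp add: T s_def)
  also have "\<dots> = (\<Sum>j\<in>T. r s j * (pair_prod r T * (\<Prod>i\<in>T - {j}. (x j + x i) / (x j - x i))))"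
    by (simp add: * sum_distrib_left mult_ac)
  also have "\<dots> = (\<Sum>j\<in>T. r s j * ((-1) ^ card {i \<in> T. i < j} * pair_prod r (T - {j})))"
    by (rule sum.cong[OF refl], rule arg_cong[of _ _ "(*) _"], unfold r_def, rule pair_prod_ratio_remove)
       (use T assms(3) in auto)
  finally show ?thesis by (simp add: s_def mult_ac)
qed

section \<open>Specialization of fractions along a ring homomorphism\<close>

text \<open>
  A homomorphism from a domain extends to those fractions whose denominator it sends to a
  unit.  The target need not be a field, nor a domain, and a fraction may be reduced before it is
  specialized; so the extension is a relation.
\<close>

locale specialization =
  fixes \<phi> :: "'r::idom \<Rightarrow> 's::comm_ring_1"
  assumes hom_add: "\<phi> (p + q) = \<phi> p + \<phi> q"
    and hom_mult: "\<phi> (p * q) = \<phi> p * \<phi> q"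
    and hom_one: "\<phi> 1 = 1"
begin

definition specializes :: "'r fract \<Rightarrow> 's \<Rightarrow> bool" where
  "specializes f F \<longleftrightarrow> (\<exists>p d D. f = Fract p d \<and> d \<noteq> 0 \<and> \<phi> d * D = 1 \<and> F = \<phi> p * D)"

lemma hom_zero: "\<phi> 0 = 0"
  using hom_add[of 0 0] by simp

lemma hom_uminus: "\<phi> (- p) = - \<phi> p"
  using hom_add[of p "- p"] by (simp add: hom_zero add_eq_0_iff)

lemma hom_diff: "\<phi> (p - q) = \<phi> p - \<phi> q"
  using hom_add[of p "- q"] by (simp add: hom_uminus)

lemma hom_sum: "\<phi> (\<Sum>i\<in>A. f i) = (\<Sum>i\<in>A. \<phi> (f i))"
  by (induction A rule: infinite_finite_induct) (simp_all add: hom_zero hom_add)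

lemma hom_prod: "\<phi> (\<Prod>i\<in>A. f i) = (\<Prod>i\<in>A. \<phi> (f i))"
  by (induction A rule: infinite_finite_induct) (simp_all add: hom_one hom_mult)

lemma hom_of_nat: "\<phi> (of_nat n) = of_nat n"
  by (induction n) (simp_all add: hom_zero hom_one hom_add)

lemma specializes_unique:
  assumes "specializes f F" "specializes f G"
  shows "F = G"
proof -
  obtain p d D where 1: "f = Fract p d" "d \<noteq> 0" "\<phi> d * D = 1" "F = \<phi> p * D"
    using assms(1) unfolding specializes_def by blast
  obtain q e E where 2: "f = Fract q e" "e \<noteq> 0" "\<phi> e * E = 1" "G = \<phi> q * E"
    using assms(2) unfolding specializes_def by blast
  have "p * e = q * d" using 1 2 by (simp add: eq_fract)
  hence *: "\<phi> p * \<phi> e = \<phi> q * \<phi> d" by (metis hom_mult)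
  have "F = \<phi> p * D * (\<phi> e * E)" using 1 2 by simp
  also have "\<dots> = (\<phi> p * \<phi> e) * (D * E)" by (simp add: mult_ac)
  also have "\<dots> = \<phi> q * E * (\<phi> d * D)" by (subst *) (simp add: mult_ac)
  also have "\<dots> = G" using 1 2 by simp
  finally show ?thesis .
qed

lemma specializes_one: "specializes 1 1"
  unfolding specializes_def by (rule exI[of _ 1], rule exI[of _ 1], rule exI[of _ 1]) (simp add: One_fract_def hom_one)

lemma specializes_zero: "specializes 0 0"
  unfolding specializes_def by (rule exI[of _ 0], rule exI[of _ 1], rule exI[of _ 1]) (simp add: Zero_fract_def hom_one hom_zero)

lemma specializes_uminus:
  assumes "specializes f F" shows "specializes (- f) (- F)"
proof -
  obtain p d D where "f = Fract p d" "d \<noteq> 0" "\<phi> d * D = 1" "F = \<phi> p * D"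
    using assms unfolding specializes_def by blast
  thus ?thesis unfolding specializes_def
    by (intro exI[of _ "- p"] exI[of _ d] exI[of _ D]) (simp add: hom_uminus)
qed

lemma specializes_add:
  assumes "specializes f F" "specializes g G" shows "specializes (f + g) (F + G)"
proof -
  obtain p d D where 1: "f = Fract p d" "d \<noteq> 0" "\<phi> d * D = 1" "F = \<phi> p * D"
    using assms(1) unfolding specializes_def by blast
  obtain q e E where 2: "g = Fract q e" "e \<noteq> 0" "\<phi> e * E = 1" "G = \<phi> q * E"
    using assms(2) unfolding specializes_def by blast
  have "\<phi> (p * e + q * d) * (D * E) = \<phi> p * D * (\<phi> e * E) + \<phi> q * E * (\<phi> d * D)"
    by (simp add: hom_add hom_mult algebra_simps)
  hence "F + G = \<phi> (p * e + q * d) * (D * E)" using 1 2 by simp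
  moreover have "\<phi> (d * e) * (D * E) = (\<phi> d * D) * (\<phi> e * E)" by (simp add: hom_mult mult_ac)
  ultimately show ?thesis unfolding specializes_def using 1 2
    by (intro exI[of _ "p * e + q * d"] exI[of _ "d * e"] exI[of _ "D * E"]) simp
qed

lemma specializes_mult:
  assumes "specializes f F" "specializes g G" shows "specializes (f * g) (F * G)"
proof -
  obtain p d D where 1: "f = Fract p d" "d \<noteq> 0" "\<phi> d * D = 1" "F = \<phi> p * D"
    using assms(1) unfolding specializes_def by blast
  obtain q e E where 2: "g = Fract q e" "e \<noteq> 0" "\<phi> e * E = 1" "G = \<phi> q * E"
    using assms(2) unfolding specializes_def by blast
  have "\<phi> (d * e) * (D * E) = (\<phi> d * D) * (\<phi> e * E)" by (simp add: hom_mult mult_ac)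
  thus ?thesis unfolding specializes_def using 1 2
    by (intro exI[of _ "p * q"] exI[of _ "d * e"] exI[of _ "D * E"]) (simp add: hom_mult mult_ac)
qed

lemma specializes_sum:
  assumes "\<And>i. i \<in> A \<Longrightarrow> specializes (f i) (F i)"
  shows "specializes (\<Sum>i\<in>A. f i) (\<Sum>i\<in>A. F i)"
  using assms by (induction A rule: infinite_finite_induct) (auto intro: specializes_zero specializes_add)

lemma specializes_prod:
  assumes "\<And>i. i \<in> A \<Longrightarrow> specializes (f i) (F i)"
  shows "specializes (\<Prod>i\<in>A. f i) (\<Prod>i\<in>A. F i)"
  using assms by (induction A rule: infinite_finite_induct) (auto intro: specializes_one specializes_mult)

lemma specializes_sign: "specializes ((-1) ^ n) ((-1) ^ n)"
  by (induction n) (auto intro: specializes_one specializes_uminus)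

lemma specializes_pair_prod:
  assumes "\<And>i j. i \<in> S \<Longrightarrow> j \<in> S \<Longrightarrow> i < j \<Longrightarrow> specializes (r i j) (a i j)"
  shows "specializes (pair_prod r S) (pair_prod a S)"
  unfolding pair_prod_def by (rule specializes_prod) (use assms in auto)

context
  fixes S :: "nat set" and x :: "nat \<Rightarrow> 'r" and a :: "nat \<Rightarrow> nat \<Rightarrow> 's"
  assumes fin: "finite S" and inj: "inj_on x S"
    and nz: "\<And>i j. i \<in> S \<Longrightarrow> j \<in> S \<Longrightarrow> x i + x j \<noteq> 0"
    and spec: "\<And>i j. i \<in> S \<Longrightarrow> j \<in> S \<Longrightarrow> i < j \<Longrightarrow> specializes (Fract (x i - x j) (x i + x j)) (a i j)"
begin

lemma specialized_variables:
  defines "X \<equiv> \<lambda>i. Fract (x i) 1"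
  defines "r \<equiv> \<lambda>i j. (X i - X j) / (X i + X j)"
  shows "inj_on X S" "\<And>i j. i \<in> S \<Longrightarrow> j \<in> S \<Longrightarrow> X i + X j \<noteq> 0"
    "\<And>i j. i \<in> S \<Longrightarrow> j \<in> S \<Longrightarrow> i < j \<Longrightarrow> specializes (r i j) (a i j)"
  using inj nz spec by (auto simp: X_def r_def inj_on_def eq_fract Zero_fract_def)

text \<open>
  The two expansions transfer along a specialization, because both sides specialize the same element
  of the field of fractions.
\<close>

lemma pair_prod_specialized_odd:
  assumes "odd (card S)"
  shows "pair_prod a S = (\<Sum>j\<in>S. (-1) ^ card {i \<in> S. i < j} * pair_prod a (S - {j}))"
  by (rule specializes_unique[OF specializes_pair_prod],
      erule (2) specialized_variables(3),
      subst pair_prod_ratio_odd[OF fin specialized_variables(1,2) assms], assumption+,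
      intro specializes_sum specializes_mult specializes_sign specializes_pair_prod specialized_variables(3))
     auto

lemma pair_prod_specialized_even:
  assumes "even (card S)" "S \<noteq> {}"
  shows "pair_prod a S = (\<Sum>j\<in>S - {Min S}. (-1) ^ card {i \<in> S - {Min S}. i < j} * a (Min S) j *
                            pair_prod a (S - {Min S} - {j}))"
proof -
  have Min: "Min S \<in> S" "\<And>j. j \<in> S - {Min S} \<Longrightarrow> Min S < j"
    using fin assms(2) by (auto simp: less_le)
  show ?thesis
  by (rule specializes_unique[OF specializes_pair_prod],
      erule (2) specialized_variables(3),
      subst pair_prod_ratio_even[OF fin specialized_variables(1,2) assms], assumption+,
      intro specializes_sum specializes_mult specializes_sign specializes_pair_prod specialized_variables(3))
     (use Min in auto)
qed

end

end
section \<open>Falling factorials\<close>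

lemma falling_factorial_0 [simp]: "falling_factorial x 0 = 1"
  by (simp add: falling_factorial_def)

lemma falling_factorial_Suc: "falling_factorial x (Suc n) = falling_factorial x n * (x - of_nat n)"
  by (simp add: falling_factorial_def)

lemma falling_factorial_Suc_left: "falling_factorial x (Suc n) = x * falling_factorial (x - 1) n"
  unfolding falling_factorial_def by (subst prod.lessThan_Suc_shift) (simp add: algebra_simps)

lemma falling_factorial_pochhammer: "falling_factorial x n = (-1) ^ n * pochhammer (- x) n"
  by (induction n) (simp_all add: falling_factorial_Suc pochhammer_Suc algebra_simps)

text \<open>
  The Vandermonde convolution, read off from the one for rising factorials by a change of signs.
\<close>

lemma falling_factorial_add:
  "falling_factorial (x + y) n =
     (\<Sum>a\<le>n. of_nat (n choose a) * (falling_factorial x a * falling_factorial y (n - a)))"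
proof -
  have "falling_factorial (x + y) n = (-1) ^ n * pochhammer (- x + - y) n"
    by (simp add: falling_factorial_pochhammer)
  also have "\<dots> = (\<Sum>a\<le>n. (-1) ^ n * (of_nat (n choose a) * pochhammer (- x) a * pochhammer (- y) (n - a)))"
    unfolding pochhammer_binomial_sum sum_distrib_left ..
  also have "\<dots> = (\<Sum>a\<le>n. of_nat (n choose a) * (falling_factorial x a * falling_factorial y (n - a)))"
  proof (rule sum.cong[OF refl])
    fix a assume "a \<in> {..n}"
    hence "(-1 :: 'a) ^ n = (-1) ^ a * (-1) ^ (n - a)" by (simp flip: power_add)
    thus "(-1) ^ n * (of_nat (n choose a) * pochhammer (- x) a * pochhammer (- y) (n - a)) =
      of_nat (n choose a) * (falling_factorial x a * falling_factorial y (n - a))"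
      unfolding falling_factorial_pochhammer by (simp only: mult_ac)
  qed
  finally show ?thesis .
qed

lemma (in specialization) hom_falling_factorial:
  "\<phi> (falling_factorial x n) = falling_factorial (\<phi> x) n"
  by (simp add: falling_factorial_def hom_prod hom_diff hom_of_nat)

section \<open>Polynomials as Laurent series\<close>

abbreviation lookup :: "('a \<Rightarrow>\<^sub>0 'b::zero) \<Rightarrow> 'a \<Rightarrow> 'b" where "lookup \<equiv> Poly_Mapping.lookup"

lemma map_int_plus: "Poly_Mapping.map int (m + m') = Poly_Mapping.map int m + Poly_Mapping.map int m'"
  by (rule poly_mapping_eqI) (simp add: Poly_Mapping.map.rep_eq lookup_add when_def)

lemma map_int_zero [simp]: "Poly_Mapping.map int 0 = 0"
  by (rule poly_mapping_eqI) (simp add: Poly_Mapping.map.rep_eq when_def)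

lemma lookup_map_int: "lookup (Poly_Mapping.map int m) i = int (lookup m i)"
  by (simp add: Poly_Mapping.map.rep_eq when_def)

lemma lcoeff_laurent_of_single:
  "lcoeff (laurent_of_poly (Poly_Mapping.single m a)) c = (if c = Poly_Mapping.map int m then a else 0)"
  by (auto simp: lcoeff_laurent_of_poly lookup_single when_def lookup_map_int map_int_nat map_nat_int)

lemma laurent_of_single_mult:
  "laurent_of_poly (Poly_Mapping.single m a * Poly_Mapping.single m' b) =
     laurent_of_poly (Poly_Mapping.single m a) * laurent_of_poly (Poly_Mapping.single m' b)"
proof (rule laurent_eqI)
  fix c
  have "lcoeff (laurent_of_poly (Poly_Mapping.single m a) * laurent_of_poly (Poly_Mapping.single m' b)) c =
    (\<Sum>e\<in>{Poly_Mapping.map int m}. lcoeff (laurent_of_poly (Poly_Mapping.single m a)) e *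
       lcoeff (laurent_of_poly (Poly_Mapping.single m' b)) (c - e))"
    unfolding lcoeff_mult
    by (rule conv_eq_sum) (auto simp: lcoeff_laurent_of_single split: if_splits)
  thus "lcoeff (laurent_of_poly (Poly_Mapping.single m a * Poly_Mapping.single m' b)) c =
    lcoeff (laurent_of_poly (Poly_Mapping.single m a) * laurent_of_poly (Poly_Mapping.single m' b)) c"
    by (auto simp: mult_single lcoeff_laurent_of_single map_int_plus algebra_simps)
qed

lemma laurent_of_poly_add: "laurent_of_poly (p + q) = laurent_of_poly p + laurent_of_poly q"
  by (rule laurent_eqI) (simp add: lcoeff_laurent_of_poly lookup_add)

lemma laurent_of_poly_zero: "laurent_of_poly 0 = 0"
  by (rule laurent_eqI) (simp add: lcoeff_laurent_of_poly)

lemma mpoly_induct [case_names zero add]: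
  assumes "P 0" and "\<And>m a p. P p \<Longrightarrow> P (Poly_Mapping.single m a + p)"
  shows "P (p :: 'a \<Rightarrow>\<^sub>0 'b::comm_monoid_add)"
proof (induction p rule: update_induct)
  case const
  show ?case by (rule assms)
next
  case (update p m a)
  hence "Poly_Mapping.update m a p = Poly_Mapping.single m a + p"
    by (intro poly_mapping_eqI) (auto simp: lookup_update lookup_add lookup_single when_def in_keys_iff)
  thus ?case using assms(2) update by simp
qed

lemma laurent_of_poly_mult: "laurent_of_poly (p * q) = laurent_of_poly p * laurent_of_poly q"
proof (induction p rule: mpoly_induct)
  case zero
  show ?case by (simp add: laurent_of_poly_zero)
next
  case (add m a p)
  have "laurent_of_poly (Poly_Mapping.single m a * q) =
          laurent_of_poly (Poly_Mapping.single m a) * laurent_of_poly q"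
    by (induction q rule: mpoly_induct)
       (simp_all add: laurent_of_poly_zero laurent_of_poly_add laurent_of_single_mult distrib_left)
  thus ?case using add by (simp add: laurent_of_poly_add distrib_right)
qed

lemma laurent_of_poly_one: "laurent_of_poly 1 = 1"
  using lcoeff_laurent_of_single[of 0 1] by (intro laurent_eqI) (simp add: lcoeff_1)

interpretation poly: specialization laurent_of_poly
  by unfold_locales (fact laurent_of_poly_add laurent_of_poly_mult laurent_of_poly_one)+

section \<open>Laurent series in a given set of variables\<close>

definition laurent_in :: "nat set \<Rightarrow> laurent \<Rightarrow> bool" where
  "laurent_in U F \<longleftrightarrow> (\<forall>c. lcoeff F c \<noteq> 0 \<longrightarrow> Poly_Mapping.keys c \<subseteq> U)"

lemma laurent_in_UNIV [simp]: "laurent_in UNIV F"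
  by (simp add: laurent_in_def)

lemma laurent_in_mono: "laurent_in U F \<Longrightarrow> U \<subseteq> V \<Longrightarrow> laurent_in V F"
  by (auto simp: laurent_in_def)

lemma laurent_in_0: "laurent_in U 0"
  by (simp add: laurent_in_def)

lemma laurent_in_1: "laurent_in U 1"
  by (simp add: laurent_in_def lcoeff_1)

lemma laurent_in_add: "laurent_in U F \<Longrightarrow> laurent_in U G \<Longrightarrow> laurent_in U (F + G)"
  unfolding laurent_in_def by (metis add.right_neutral lcoeff_add)

lemma laurent_in_uminus: "laurent_in U F \<Longrightarrow> laurent_in U (- F)"
  by (simp add: laurent_in_def)

lemma laurent_in_diff: "laurent_in U F \<Longrightarrow> laurent_in U G \<Longrightarrow> laurent_in U (F - G)"
  using laurent_in_add[of U F "- G"] laurent_in_uminus[of U G] by simp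

lemma laurent_in_mult:
  assumes "laurent_in U F" "laurent_in U G"
  shows "laurent_in U (F * G)"
  unfolding laurent_in_def lcoeff_mult
proof (intro allI impI)
  fix c assume "conv (lcoeff F) (lcoeff G) c \<noteq> 0"
  then obtain e where e: "lcoeff F e \<noteq> 0" "lcoeff G (c - e) \<noteq> 0" by (rule conv_nonzeroE)
  have "Poly_Mapping.keys c = Poly_Mapping.keys (e + (c - e))" by simp
  also have "\<dots> \<subseteq> Poly_Mapping.keys e \<union> Poly_Mapping.keys (c - e)" by (rule Poly_Mapping.keys_add)
  also have "\<dots> \<subseteq> U" using assms e by (auto simp: laurent_in_def)
  finally show "Poly_Mapping.keys c \<subseteq> U" .
qed

lemma laurent_in_sum: "(\<And>i. i \<in> A \<Longrightarrow> laurent_in U (F i)) \<Longrightarrow> laurent_in U (\<Sum>i\<in>A. F i)"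
  by (induction A rule: infinite_finite_induct) (auto intro: laurent_in_0 laurent_in_add)

lemma laurent_in_prod: "(\<And>i. i \<in> A \<Longrightarrow> laurent_in U (F i)) \<Longrightarrow> laurent_in U (\<Prod>i\<in>A. F i)"
  by (induction A rule: infinite_finite_induct) (auto intro: laurent_in_1 laurent_in_mult)

lemma laurent_in_of_nat: "laurent_in U (of_nat n)"
  by (induction n) (auto intro: laurent_in_0 laurent_in_1 laurent_in_add)

lemma laurent_in_falling_factorial: "laurent_in U F \<Longrightarrow> laurent_in U (falling_factorial F n)"
  unfolding falling_factorial_def by (intro laurent_in_prod laurent_in_diff laurent_in_of_nat)

abbreviation lvar :: "nat \<Rightarrow> laurent" where
  "lvar i \<equiv> laurent_of_poly (pvar i)"

definition lconst :: "rat \<Rightarrow> laurent" where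
  "lconst a = laurent_of_poly (pconst a)"

lemma lookup_map_int_single: "Poly_Mapping.map int (Poly_Mapping.single i n) = Poly_Mapping.single i (int n)"
  by (rule poly_mapping_eqI) (simp add: lookup_map_int lookup_single when_def)

lemma lcoeff_lvar: "lcoeff (lvar i) c = (if c = Poly_Mapping.single i 1 then 1 else 0)"
  by (simp add: pvar_def lcoeff_laurent_of_single lookup_map_int_single)

lemma lcoeff_lconst: "lcoeff (lconst a) c = (if c = 0 then a else 0)"
  by (simp add: lconst_def pconst_def lcoeff_laurent_of_single)

lemma lconst_add: "lconst (a + b) = lconst a + lconst b"
  by (rule laurent_eqI) (simp add: lcoeff_lconst)

lemma lconst_zero: "lconst 0 = 0"
  by (rule laurent_eqI) (simp add: lcoeff_lconst)

lemma lconst_one: "lconst 1 = 1"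
  by (rule laurent_eqI) (simp add: lcoeff_lconst lcoeff_1)

lemma lconst_uminus: "lconst (- a) = - lconst a"
  by (rule laurent_eqI) (simp add: lcoeff_lconst)

lemma lconst_mult: "lconst (a * b) = lconst a * lconst b"
  by (simp add: lconst_def pconst_def mult_single flip: laurent_of_poly_mult)

lemma lconst_sum: "lconst (\<Sum>i\<in>A. f i) = (\<Sum>i\<in>A. lconst (f i))"
  by (induction A rule: infinite_finite_induct) (simp_all add: lconst_zero lconst_add)

lemma lconst_of_nat: "lconst (of_nat n) = of_nat n"
  by (induction n) (simp_all add: lconst_zero lconst_add lconst_one)

lemma lconst_sign: "lconst ((-1) ^ n) = (-1) ^ n"
  by (induction n) (simp_all add: lconst_uminus lconst_one)

lemma laurent_in_lvar: "i \<in> U \<Longrightarrow> laurent_in U (lvar i)"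
  by (auto simp: laurent_in_def lcoeff_lvar)

lemma laurent_in_lconst: "laurent_in U (lconst a)"
  by (auto simp: laurent_in_def lcoeff_lconst)

lemma laurent_in_inv_sum:
  assumes "i < j" "{i, j} \<subseteq> U"
  shows "laurent_in U (inv_sum i j)"
  unfolding laurent_in_def
proof (intro allI impI)
  fix c assume "lcoeff (inv_sum i j) c \<noteq> 0"
  then obtain r where c: "c = inv_exponent i j r"
    using lcoeff_inv_sum_eq_0[OF assms(1)] by blast
  show "Poly_Mapping.keys c \<subseteq> U"
    using assms by (auto simp: c in_keys_iff lookup_inv_exponent split: if_splits)
qed

section \<open>The polynomial component of a Laurent series\<close>

definition nonneg_part :: "laurent \<Rightarrow> laurent" where
  "nonneg_part F = Abs_laurent (\<lambda>c. if \<forall>i. lookup c i \<ge> 0 then lcoeff F c else 0)"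

lemma lcoeff_nonneg_part:
  "lcoeff (nonneg_part F) c = (if \<forall>i. lookup c i \<ge> 0 then lcoeff F c else 0)"
proof -
  let ?f = "\<lambda>c. if \<forall>i. lookup c i \<ge> 0 then lcoeff F c else 0"
  obtain K N where "{c. lcoeff F c \<noteq> 0} \<subseteq> lsupp K N"
    using is_laurent_lcoeff[of F] unfolding is_laurent_def by blast
  hence "{c. ?f c \<noteq> 0} \<subseteq> lsupp K N" by auto
  hence "is_laurent ?f" unfolding is_laurent_def by blast
  thus ?thesis by (simp add: nonneg_part_def)
qed

lemma polynomial_component_eq: "polynomial_component k f = nonneg_part (expansion k f)"
  by (rule laurent_eqI) (simp add: lcoeff_polynomial_component lcoeff_nonneg_part)

lemma nonneg_part_add: "nonneg_part (F + G) = nonneg_part F + nonneg_part G"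
  by (rule laurent_eqI) (simp add: lcoeff_nonneg_part)

lemma nonneg_part_zero: "nonneg_part 0 = 0"
  by (rule laurent_eqI) (simp add: lcoeff_nonneg_part)

lemma nonneg_part_sum: "nonneg_part (\<Sum>i\<in>A. F i) = (\<Sum>i\<in>A. nonneg_part (F i))"
  by (induction A rule: infinite_finite_induct) (simp_all add: nonneg_part_zero nonneg_part_add)

lemma nonneg_part_laurent_of_poly: "nonneg_part (laurent_of_poly p) = laurent_of_poly p"
  by (rule laurent_eqI) (simp add: lcoeff_nonneg_part lcoeff_laurent_of_poly)

text \<open>
  Splitting the exponents of a monomial into those in \<open>U\<close> and those outside is the only way in which it can
  arise in the product, and the monomial is non-negative if and only if both parts are.
\<close>

lemma nonneg_part_mult:
  assumes F: "laurent_in U F" and G: "laurent_in V G" and "U \<inter> V = {}"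
  shows "nonneg_part (F * G) = nonneg_part F * nonneg_part G"
proof (rule laurent_eqI)
  fix c
  have split: "lookup e i = (if i \<in> U then lookup c i else 0)" "lookup (c - e) i = (if i \<in> U then 0 else lookup c i)"
    if "lcoeff F e \<noteq> 0" "lcoeff G (c - e) \<noteq> 0" for e i
  proof -
    have "Poly_Mapping.keys e \<subseteq> U" "Poly_Mapping.keys (c - e) \<subseteq> V"
      using F G that by (auto simp: laurent_in_def)
    hence "i \<notin> U \<Longrightarrow> lookup e i = 0" "i \<in> U \<Longrightarrow> lookup (c - e) i = 0"
      using assms(3) by (auto simp: in_keys_iff)
    thus "lookup e i = (if i \<in> U then lookup c i else 0)"
      "lookup (c - e) i = (if i \<in> U then 0 else lookup c i)"
      by (auto simp: lookup_minus)
  qed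
  have "lcoeff (nonneg_part F) e * lcoeff (nonneg_part G) (c - e) =
          (if \<forall>i. lookup c i \<ge> 0 then lcoeff F e * lcoeff G (c - e) else 0)" for e
  proof (cases "lcoeff F e = 0 \<or> lcoeff G (c - e) = 0")
    case False
    have "lookup c i \<ge> 0 \<longleftrightarrow> lookup e i \<ge> 0 \<and> lookup (c - e) i \<ge> 0" for i
      using split[of e i] False by auto
    thus ?thesis by (auto simp: lcoeff_nonneg_part)
  qed (auto simp: lcoeff_nonneg_part)
  hence "lcoeff (nonneg_part F * nonneg_part G) c =
           Sum_any (\<lambda>e. if \<forall>i. lookup c i \<ge> 0 then lcoeff F e * lcoeff G (c - e) else 0)"
    by (simp only: lcoeff_mult conv_def)
  also have "\<dots> = (if \<forall>i. lookup c i \<ge> 0 then lcoeff (F * G) c else 0)"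
    by (cases "\<forall>i. lookup c i \<ge> 0") (simp_all only: lcoeff_mult conv_def if_True if_False, simp_all)
  finally show "lcoeff (nonneg_part (F * G)) c = lcoeff (nonneg_part F * nonneg_part G) c"
    by (simp only: lcoeff_nonneg_part)
qed

lemma nonneg_part_lconst_mult: "nonneg_part (lconst a * F) = lconst a * nonneg_part F"
  by (subst nonneg_part_mult[OF laurent_in_lconst[of "{}"] laurent_in_UNIV[of F]])
     (simp_all add: lconst_def nonneg_part_laurent_of_poly)

definition ratio :: "nat \<Rightarrow> nat \<Rightarrow> laurent" where
  "ratio i j = (lvar i - lvar j) * inv_sum i j"

lemma laurent_in_ratio: "i < j \<Longrightarrow> {i, j} \<subseteq> U \<Longrightarrow> laurent_in U (ratio i j)"
  unfolding ratio_def by (intro laurent_in_mult laurent_in_diff laurent_in_lvar laurent_in_inv_sum) auto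

lemma lvar_add_mult_inv_sum: "i < j \<Longrightarrow> (lvar i + lvar j) * inv_sum i j = 1"
  using inv_sum_inverse[of i j] by (simp add: laurent_of_poly_add)

text \<open>
  The quotient is \<open>1 - 2 x\<^sub>j / (x\<^sub>i + x\<^sub>j)\<close>, and every term of the expansion of
  \<open>x\<^sub>j / (x\<^sub>i + x\<^sub>j)\<close> has a negative exponent at \<open>x\<^sub>i\<close>.
\<close>

lemma nonneg_part_ratio:
  assumes "i < j"
  shows "nonneg_part (ratio i j) = 1"
proof -
  have "ratio i j = 1 + lconst (-2) * (lvar j * inv_sum i j)"
  proof -
    have "ratio i j = (lvar i + lvar j) * inv_sum i j - 2 * (lvar j * inv_sum i j)"
      by (simp add: ratio_def algebra_simps)
    also have "(2 :: laurent) = lconst 2" using lconst_of_nat[of 2] by simp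
    finally show ?thesis by (simp add: lvar_add_mult_inv_sum[OF assms] lconst_uminus)
  qed
  moreover have "nonneg_part (lvar j * inv_sum i j) = 0"
  proof (rule laurent_eqI)
    fix c
    have "lcoeff (lvar j * inv_sum i j) c = 0" if c: "\<forall>l. lookup c l \<ge> 0"
    proof -
      have "lcoeff (lvar j * inv_sum i j) c =
              (\<Sum>e\<in>{Poly_Mapping.single j 1}. lcoeff (lvar j) e * lcoeff (inv_sum i j) (c - e))"
        unfolding lcoeff_mult by (rule conv_eq_sum) (auto simp: lcoeff_lvar split: if_splits)
      moreover have "lcoeff (inv_sum i j) (c - Poly_Mapping.single j 1) = 0"
      proof (rule lcoeff_inv_sum_eq_0[OF assms], rule notI)
        fix r assume "c - Poly_Mapping.single j 1 = inv_exponent i j r"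
        hence "lookup (c - Poly_Mapping.single j 1) i = lookup (inv_exponent i j r) i" by simp
        hence "lookup c i = - 1 - int r"
          using assms by (simp add: lookup_inv_exponent lookup_minus lookup_single when_def)
        thus False using c[rule_format, of i] by simp
      qed
      ultimately show ?thesis by simp
    qed
    thus "lcoeff (nonneg_part (lvar j * inv_sum i j)) c = lcoeff 0 c"
      by (simp add: lcoeff_nonneg_part)
  qed
  moreover have "nonneg_part 1 = 1"
    using nonneg_part_laurent_of_poly[of 1] by (simp add: laurent_of_poly_one)
  ultimately show ?thesis by (simp add: nonneg_part_add nonneg_part_lconst_mult)
qed
section \<open>Multinomial sums of falling factorials\<close>

definition exponents :: "nat set \<Rightarrow> nat \<Rightarrow> (nat \<Rightarrow> nat) set" where
  "exponents U n = {m. m \<in> U \<rightarrow>\<^sub>E UNIV \<and> (\<Sum>i\<in>U. m i) = n}"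

definition multinomial_sum :: "nat set \<Rightarrow> ((nat \<Rightarrow> nat) \<Rightarrow> rat) \<Rightarrow> nat \<Rightarrow> laurent" where
  "multinomial_sum U h n = (\<Sum>m\<in>exponents U n.
     lconst (h m * (fact n / (\<Prod>i\<in>U. fact (m i)))) * (\<Prod>i\<in>U. falling_factorial (lvar i) (m i)))"

lemma finite_exponents:
  assumes "finite U" shows "finite (exponents U n)"
proof (rule finite_subset)
  show "exponents U n \<subseteq> U \<rightarrow>\<^sub>E {..n}"
    using assms by (auto simp: exponents_def PiE_def Pi_def intro: member_le_sum)
  show "finite (U \<rightarrow>\<^sub>E {..n})" by (rule finite_PiE) (use assms in auto)
qed

text \<open>
  An exponent on the union is a pair of exponents on the two parts, and \<open>n! / \<Prod>i. m\<^sub>i!\<close> is the product of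
  the two corresponding multinomial coefficients and the binomial coefficient \<open>n choose a\<close>.
\<close>

lemma multinomial_sum_union:
  assumes "finite U" "finite V" "U \<inter> V = {}"
  shows "multinomial_sum (U \<union> V) (\<lambda>m. h (restrict m U) * h' (restrict m V)) n =
           (\<Sum>a\<le>n. of_nat (n choose a) * (multinomial_sum U h a * multinomial_sum V h' (n - a)))"
proof -
  let ?c = "\<lambda>U h n m. lconst (h m * (fact n / (\<Prod>i\<in>U. fact (m i))))"
  let ?p = "\<lambda>U m. \<Prod>i\<in>U. falling_factorial (lvar i) (m i)"
  let ?T = "\<lambda>(a, m, m'). of_nat (n choose a) * ((?c U h a m * ?p U m) * (?c V h' (n - a) m' * ?p V m'))"
  have "(\<Sum>a\<le>n. of_nat (n choose a) * (multinomial_sum U h a * multinomial_sum V h' (n - a))) =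
        (\<Sum>a\<le>n. \<Sum>(m, m')\<in>exponents U a \<times> exponents V (n - a). ?T (a, m, m'))"
    unfolding multinomial_sum_def sum_product
    unfolding sum_distrib_left sum.cartesian_product by (simp only: case_prod_unfold fst_conv snd_conv)
  also have "\<dots> = (\<Sum>t\<in>(SIGMA a:{..n}. exponents U a \<times> exponents V (n - a)). ?T t)"
    using assms finite_exponents by (subst sum.Sigma) (auto simp: case_prod_unfold)
  also have "\<dots> = multinomial_sum (U \<union> V) (\<lambda>m. h (restrict m U) * h' (restrict m V)) n"
    unfolding multinomial_sum_def
  proof (rule sum.reindex_bij_witness[where
          i = "\<lambda>m. (\<Sum>i\<in>U. m i, restrict m U, restrict m V)" and
          j = "\<lambda>(a, m, m') i. if i \<in> U then m i else m' i"])
    fix m assume m: "m \<in> exponents (U \<union> V) n"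
    hence sum: "(\<Sum>i\<in>U. m i) + (\<Sum>i\<in>V. m i) = n"
      using assms by (simp add: exponents_def sum.union_disjoint)
    show "(\<lambda>(a, m, m') i. if i \<in> U then m i else m' i) (\<Sum>i\<in>U. m i, restrict m U, restrict m V) = m"
      using m by (auto simp: exponents_def PiE_iff extensional_def fun_eq_iff)
    show "(\<Sum>i\<in>U. m i, restrict m U, restrict m V) \<in> (SIGMA a:{..n}. exponents U a \<times> exponents V (n - a))"
      using sum by (auto simp: exponents_def)
  next
    fix t assume t: "t \<in> (SIGMA a:{..n}. exponents U a \<times> exponents V (n - a))"
    obtain a m1 m2 where t_eq: "t = (a, m1, m2)" by (cases t)
    \<comment> \<open>Outside \<open>U \<union> V\<close> this is the default value of \<open>m2\<close>, as membership in \<open>PiE\<close> requires.\<close>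
    define m where "m = (\<lambda>i. if i \<in> U then m1 i else m2 i)"
    have t': "a \<le> n" "m1 \<in> exponents U a" "m2 \<in> exponents V (n - a)" using t by (auto simp: t_eq)
    have eqU: "m i = m1 i" if "i \<in> U" for i using that by (simp add: m_def)
    have eqV: "m i = m2 i" if "i \<in> V" for i using that assms(3) by (auto simp: m_def)
    have r: "restrict m U = m1" "restrict m V = m2"
      using t' eqU eqV by (auto simp: exponents_def PiE_iff extensional_def fun_eq_iff)
    have s: "(\<Sum>i\<in>U. m i) = a" "(\<Sum>i\<in>V. m i) = n - a"
      using t' eqU eqV by (simp_all add: exponents_def)
    have jm: "(\<lambda>(a, m, m') i. if i \<in> U then m i else m' i) t = m" by (simp add: t_eq m_def)
    have "m i = undefined" if "i \<notin> U \<union> V" for i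
      using that t' by (auto simp: m_def exponents_def PiE_iff extensional_def)
    thus "(\<lambda>(a, m, m') i. if i \<in> U then m i else m' i) t \<in> exponents (U \<union> V) n"
      unfolding jm using assms s t'(1) by (simp add: exponents_def sum.union_disjoint PiE_iff extensional_def)
    show "(\<Sum>i\<in>U. (\<lambda>(a, m, m') i. if i \<in> U then m i else m' i) t i,
            restrict ((\<lambda>(a, m, m') i. if i \<in> U then m i else m' i) t) U,
            restrict ((\<lambda>(a, m, m') i. if i \<in> U then m i else m' i) t) V) = t"
      unfolding jm by (simp add: t_eq r s)
    have p: "(\<Prod>i\<in>U \<union> V. f i (m i)) = (\<Prod>i\<in>U. f i (m1 i)) * (\<Prod>i\<in>V. f i (m2 i))"
      for f :: "nat \<Rightarrow> nat \<Rightarrow> 'b::comm_monoid_mult"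
      using assms by (simp add: prod.union_disjoint eqU eqV)
    have "rat_of_nat (n choose a) * (fact a / x) * (fact (n - a) / y) = fact n / (x * y)" for x y :: rat
      using t'(1) by (simp add: binomial_fact)
    hence "h m1 * h' m2 * (fact n / ((\<Prod>i\<in>U. fact (m1 i)) * (\<Prod>i\<in>V. fact (m2 i)))) =
      of_nat (n choose a) * ((h m1 * (fact a / (\<Prod>i\<in>U. fact (m1 i)))) * (h' m2 * (fact (n - a) / (\<Prod>i\<in>V. fact (m2 i)))))"
      by (metis (no_types, lifting) mult.assoc mult.left_commute)
    hence coeff: "lconst (h m1 * h' m2 * (fact n / ((\<Prod>i\<in>U. fact (m1 i)) * (\<Prod>i\<in>V. fact (m2 i))))) =
        of_nat (n choose a) * (?c U h a m1 * ?c V h' (n - a) m2)"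
      by (simp only: lconst_mult lconst_of_nat)
    thus "?c (U \<union> V) (\<lambda>m. h (restrict m U) * h' (restrict m V)) n ((\<lambda>(a, m, m') i. if i \<in> U then m i else m' i) t) *
        ?p (U \<union> V) ((\<lambda>(a, m, m') i. if i \<in> U then m i else m' i) t) = ?T t"
      unfolding jm
      unfolding r p[of "\<lambda>i. falling_factorial (lvar i)"] p[of "\<lambda>_. fact"] coeff t_eq prod.case
      by (simp only: mult_ac)
  qed
  finally show ?thesis by simp
qed

section \<open>Series whose polynomial components are multinomial sums\<close>

text \<open>
  The property to be shown for \<open>F = G\<^sub>U\<close>, formulated for an arbitrary weight \<open>h\<close> of the exponents and for
  all \<open>n\<close> together, so that it is closed under linear combinations and under products in
  disjoint variables.
\<close>

definition multinomial_component :: "nat set \<Rightarrow> laurent \<Rightarrow> ((nat \<Rightarrow> nat) \<Rightarrow> rat) \<Rightarrow> bool" where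
  "multinomial_component U F h \<longleftrightarrow> laurent_in U F \<and>
     (\<forall>n. nonneg_part (F * falling_factorial (\<Sum>i\<in>U. lvar i) n) = multinomial_sum U h n)"

lemma multinomial_component_sum:
  assumes "\<And>j. j \<in> J \<Longrightarrow> multinomial_component U (F j) (h j)"
  shows "multinomial_component U (\<Sum>j\<in>J. lconst (c j) * F j) (\<lambda>m. \<Sum>j\<in>J. c j * h j m)"
  unfolding multinomial_component_def
proof safe
  show "laurent_in U (\<Sum>j\<in>J. lconst (c j) * F j)"
    using assms by (auto intro!: laurent_in_sum laurent_in_mult laurent_in_lconst simp: multinomial_component_def)
  fix n
  let ?X = "falling_factorial (\<Sum>i\<in>U. lvar i) n"
  have "nonneg_part ((\<Sum>j\<in>J. lconst (c j) * F j) * ?X) = (\<Sum>j\<in>J. lconst (c j) * nonneg_part (F j * ?X))"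
    by (simp add: sum_distrib_right nonneg_part_sum mult.assoc nonneg_part_lconst_mult)
  also have "\<dots> = (\<Sum>j\<in>J. lconst (c j) * multinomial_sum U (h j) n)"
    using assms by (intro sum.cong) (simp_all add: multinomial_component_def)
  also have "\<dots> = multinomial_sum U (\<lambda>m. \<Sum>j\<in>J. c j * h j m) n"
    unfolding multinomial_sum_def sum_distrib_left
    by (subst sum.swap, rule sum.cong[OF refl])
       (simp only: sum_distrib_right lconst_sum lconst_mult mult.assoc)
  finally show "nonneg_part ((\<Sum>j\<in>J. lconst (c j) * F j) * ?X) =
                  multinomial_sum U (\<lambda>m. \<Sum>j\<in>J. c j * h j m) n" .
qed

text \<open>
  The Vandermonde convolution on the left matches the decomposition of multinomial sums on the
  right, and the polynomial component is multiplicative across disjoint variables.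
\<close>

lemma multinomial_component_union:
  assumes F: "multinomial_component U F h" and G: "multinomial_component V G h'"
    and fin: "finite U" "finite V" "U \<inter> V = {}"
  shows "multinomial_component (U \<union> V) (F * G) (\<lambda>m. h (restrict m U) * h' (restrict m V))"
  unfolding multinomial_component_def
proof safe
  have in_F: "laurent_in U F" and in_G: "laurent_in V G"
    using F G by (simp_all add: multinomial_component_def)
  show "laurent_in (U \<union> V) (F * G)"
    using in_F in_G by (intro laurent_in_mult) (auto intro: laurent_in_mono)
  fix n
  let ?X = "\<lambda>U n. falling_factorial (\<Sum>i\<in>U. lvar i) n"
  have in_X: "laurent_in U (?X U n)" for U n
    by (intro laurent_in_falling_factorial laurent_in_sum laurent_in_lvar)
  have "F * G * ?X (U \<union> V) n = F * G * falling_factorial ((\<Sum>i\<in>U. lvar i) + (\<Sum>i\<in>V. lvar i)) n"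
    using fin by (simp add: sum.union_disjoint)
  also have "\<dots> = (\<Sum>a\<le>n. lconst (of_nat (n choose a)) * ((F * ?X U a) * (G * ?X V (n - a))))"
    unfolding falling_factorial_add sum_distrib_left
    by (rule sum.cong[OF refl]) (simp add: lconst_of_nat mult_ac)
  also have "nonneg_part \<dots> =
      (\<Sum>a\<le>n. of_nat (n choose a) * (nonneg_part (F * ?X U a) * nonneg_part (G * ?X V (n - a))))"
    unfolding nonneg_part_sum nonneg_part_lconst_mult
    by (subst nonneg_part_mult[OF laurent_in_mult[OF in_F in_X] laurent_in_mult[OF in_G in_X] fin(3)])
       (simp add: lconst_of_nat)
  also have "\<dots> = multinomial_sum (U \<union> V) (\<lambda>m. h (restrict m U) * h' (restrict m V)) n"
    using F G fin by (simp add: multinomial_sum_union multinomial_component_def)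
  finally show "nonneg_part (F * G * ?X (U \<union> V) n) =
      multinomial_sum (U \<union> V) (\<lambda>m. h (restrict m U) * h' (restrict m V)) n" .
qed

lemma multinomial_component_empty: "multinomial_component {} 1 (\<lambda>_. 1)"
proof -
  have "falling_factorial (0 :: laurent) n = (if n = 0 then 1 else 0)" for n
    by (cases n) (simp_all add: falling_factorial_Suc_left)
  moreover have "exponents {} n = (if n = 0 then {\<lambda>_. undefined} else {})" for n
    by (auto simp: exponents_def)
  ultimately show ?thesis
    using nonneg_part_laurent_of_poly[of 1]
    by (simp add: multinomial_component_def multinomial_sum_def laurent_in_1 laurent_of_poly_one
        nonneg_part_zero lconst_one)
qed

lemma multinomial_component_singleton: "multinomial_component {j} 1 (\<lambda>_. 1)"
proof -
  have "exponents {j} n = {\<lambda>i. if i = j then n else undefined}" for n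
    by (auto simp: exponents_def PiE_iff extensional_def fun_eq_iff)
  moreover have "nonneg_part (falling_factorial (lvar j) n) = falling_factorial (lvar j) n" for n
    by (simp add: nonneg_part_laurent_of_poly flip: poly.hom_falling_factorial)
  ultimately show ?thesis
    by (simp add: multinomial_component_def multinomial_sum_def laurent_in_1 lconst_one)
qed

section \<open>Two variables\<close>

definition exponent_ratio :: "(nat \<Rightarrow> nat) \<Rightarrow> nat \<Rightarrow> nat \<Rightarrow> rat" where
  "exponent_ratio m i j =
     (if m i = 0 \<and> m j = 0 then 1 else (of_nat (m i) - of_nat (m j)) / (of_nat (m i) + of_nat (m j)))"

lemma multinomial_sum_pair:
  assumes "i \<noteq> j"
  shows "multinomial_sum {i, j} h n =
    (\<Sum>a\<le>n. lconst (h (\<lambda>l. if l = i then a else if l = j then n - a else undefined) * of_nat (n choose a)) *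
      (falling_factorial (lvar i) a * falling_factorial (lvar j) (n - a)))"
  unfolding multinomial_sum_def
proof (rule sum.reindex_bij_witness[where
      j = "\<lambda>m. m i" and i = "\<lambda>a l. if l = i then a else if l = j then n - a else undefined"])
  fix m assume m: "m \<in> exponents {i, j} n"
  have sum: "m i + m j = n" using m assms by (simp add: exponents_def)
  thus "m i \<in> {..n}" by auto
  show eq: "(\<lambda>l. if l = i then m i else if l = j then n - m i else undefined) = m"
    using m sum by (auto simp: exponents_def PiE_iff extensional_def fun_eq_iff)
  have "n - m i = m j" using sum by simp
  moreover have "rat_of_nat (n choose m i) = fact n / (fact (m i) * fact (m j))"
    using sum by (subst binomial_fact) auto
  ultimately show "lconst (h (\<lambda>l. if l = i then m i else if l = j then n - m i else undefined) * of_nat (n choose m i)) *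
      (falling_factorial (lvar i) (m i) * falling_factorial (lvar j) (n - m i)) =
      lconst (h m * (fact n / (\<Prod>i\<in>{i, j}. fact (m i)))) * (\<Prod>i\<in>{i, j}. falling_factorial (lvar i) (m i))"
    unfolding eq using assms by simp
qed (use assms in \<open>auto simp: exponents_def PiE_iff extensional_def\<close>)

text \<open>
  Multiply the Vandermonde convolution of \<open>(x - 1) + y\<close> by \<open>x\<close> and that of \<open>x + (y - 1)\<close> by
  \<open>y\<close>, absorbing the factor in either case, and subtract.
\<close>

lemma falling_factorial_diff_mult:
  fixes x y :: "'a::comm_ring_1"
  shows "(x - y) * falling_factorial (x + y - 1) n =
    (\<Sum>a\<le>Suc n. (if a = 0 then 0 else of_nat (n choose (a - 1))) * (falling_factorial x a * falling_factorial y (Suc n - a))) -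
    (\<Sum>a\<le>Suc n. of_nat (n choose a) * (falling_factorial x a * falling_factorial y (Suc n - a)))"
proof -
  have "x * falling_factorial (x + y - 1) n =
          (\<Sum>a\<le>n. of_nat (n choose a) * (falling_factorial x (Suc a) * falling_factorial y (n - a)))"
    using falling_factorial_add[of "x - 1" y n]
    by (simp add: falling_factorial_Suc_left algebra_simps sum_distrib_left)
  also have "\<dots> = (\<Sum>a\<le>Suc n. (if a = 0 then 0 else of_nat (n choose (a - 1))) *
                     (falling_factorial x a * falling_factorial y (Suc n - a)))"
    by (subst sum.atMost_Suc_shift) simp
  finally have 1: "x * falling_factorial (x + y - 1) n = \<dots>" .
  have "y * falling_factorial (x + y - 1) n =
          (\<Sum>a\<le>n. of_nat (n choose a) * (falling_factorial x a * (y * falling_factorial (y - 1) (n - a))))"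
    using falling_factorial_add[of x "y - 1" n]
    by (simp add: algebra_simps sum_distrib_left)
  also have "\<dots> = (\<Sum>a\<le>n. of_nat (n choose a) * (falling_factorial x a * falling_factorial y (Suc n - a)))"
    by (rule sum.cong) (auto simp: Suc_diff_le falling_factorial_Suc_left)
  also have "\<dots> = (\<Sum>a\<le>Suc n. of_nat (n choose a) * (falling_factorial x a * falling_factorial y (Suc n - a)))"
    by (simp add: binomial_eq_0)
  finally show ?thesis unfolding left_diff_distrib 1 by simp
qed

lemma ratio_mult_binomial:
  assumes "a \<le> Suc n"
  shows "(of_nat a - of_nat (Suc n - a)) / (of_nat a + of_nat (Suc n - a)) * of_nat (Suc n choose a) =
           ((if a = 0 then 0 else of_nat (n choose (a - 1))) - of_nat (n choose a) :: 'a::field_char_0)"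
proof -
  have "of_nat a + of_nat (Suc n - a) = (of_nat (Suc n) :: 'a)"
    using assms by (simp flip: of_nat_add)
  moreover have "of_nat a * of_nat (Suc n choose a) =
                   (of_nat (Suc n) * (if a = 0 then 0 else of_nat (n choose (a - 1))) :: 'a)"
  proof (cases a)
    case (Suc b)
    have "of_nat (Suc b * (Suc n choose Suc b)) = (of_nat (Suc n * (n choose b)) :: 'a)"
      by (simp only: Suc_times_binomial)
    thus ?thesis by (simp only: Suc of_nat_mult) simp
  qed simp
  moreover have "of_nat (Suc n - a) * of_nat (Suc n choose a) = (of_nat (Suc n) * of_nat (n choose a) :: 'a)"
    using binomial_absorb_comp[of "Suc n" a] by (simp del: of_nat_Suc binomial_Suc_Suc flip: of_nat_mult)
  ultimately show ?thesis
    by (simp del: of_nat_Suc binomial_Suc_Suc add: divide_simps algebra_simps)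
qed

text \<open>
  For \<open>n > 0\<close> the denominator cancels and nothing has to be discarded; the coefficients of the remaining
  polynomial are given by \<open>ratio_mult_binomial\<close>.
\<close>

lemma multinomial_component_ratio:
  assumes "i < j"
  shows "multinomial_component {i, j} (ratio i j) (\<lambda>m. exponent_ratio m i j)"
  unfolding multinomial_component_def
proof safe
  show "laurent_in {i, j} (ratio i j)" using assms by (intro laurent_in_ratio) auto
  have ij: "i \<noteq> j" using assms by simp
  fix n
  show "nonneg_part (ratio i j * falling_factorial (\<Sum>i\<in>{i, j}. lvar i) n) =
          multinomial_sum {i, j} (\<lambda>m. exponent_ratio m i j) n"
  proof (cases n)
    case 0
    thus ?thesis
      using assms by (simp add: nonneg_part_ratio multinomial_sum_pair exponent_ratio_def lconst_one)
  next
    case (Suc n')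
    let ?x = "lvar i" and ?y = "lvar j"
    have "ratio i j * falling_factorial (\<Sum>i\<in>{i, j}. lvar i) n =
            ((?x + ?y) * inv_sum i j) * ((?x - ?y) * falling_factorial (?x + ?y - 1) n')"
      using ij by (simp add: Suc falling_factorial_Suc_left ratio_def mult_ac)
    also have "\<dots> = (?x - ?y) * falling_factorial (?x + ?y - 1) n'"
      by (simp add: lvar_add_mult_inv_sum[OF assms])
    also have "\<dots> = laurent_of_poly ((pvar i - pvar j) * falling_factorial (pvar i + pvar j - 1) n')"
      by (simp add: poly.hom_falling_factorial poly.hom_mult poly.hom_diff poly.hom_add poly.hom_one)
    also have "nonneg_part \<dots> = (?x - ?y) * falling_factorial (?x + ?y - 1) n'"
      unfolding nonneg_part_laurent_of_poly
      by (simp add: poly.hom_falling_factorial poly.hom_mult poly.hom_diff poly.hom_add poly.hom_one)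
    also have "\<dots> = (\<Sum>a\<le>n. lconst ((if a = 0 then 0 else of_nat (n' choose (a - 1))) - of_nat (n' choose a)) *
                       (falling_factorial ?x a * falling_factorial ?y (n - a)))"
      unfolding falling_factorial_diff_mult Suc sum_subtractf[symmetric] left_diff_distrib[symmetric]
      by (intro sum.cong arg_cong2[of _ _ _ _ "(*)"])
         (auto simp: lconst_of_nat lconst_uminus lconst_add lconst_zero diff_conv_add_uminus simp del: add_uminus_conv_diff)
    also have "\<dots> = multinomial_sum {i, j} (\<lambda>m. exponent_ratio m i j) n"
      unfolding multinomial_sum_pair[OF ij]
      by (intro sum.cong arg_cong2[of _ _ _ _ "(*)"] arg_cong[of _ _ lconst])
         (use ij in \<open>auto simp: Suc exponent_ratio_def ratio_mult_binomial[symmetric]\<close>)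
    finally show ?thesis .
  qed
qed

section \<open>The ratios as specializations\<close>

lemma pvar_inject: "pvar i = pvar j \<longleftrightarrow> i = j"
proof
  assume "pvar i = pvar j"
  hence "Poly_Mapping.keys (pvar i) = Poly_Mapping.keys (pvar j)" by simp
  hence "Poly_Mapping.keys (Poly_Mapping.single i (1 :: nat)) = Poly_Mapping.keys (Poly_Mapping.single j (1 :: nat))"
    by (simp add: pvar_def)
  thus "i = j" by simp
qed simp

lemma pair_prod_cong:
  assumes "\<And>i j. i \<in> S \<Longrightarrow> j \<in> S \<Longrightarrow> i < j \<Longrightarrow> a i j = b i j"
  shows "pair_prod a S = pair_prod b S"
  unfolding pair_prod_def by (rule prod.cong) (use assms in auto)

lemma specializes_ratio:
  assumes "i < j"
  shows "poly.specializes (Fract (pvar i - pvar j) (pvar i + pvar j)) (ratio i j)"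
  unfolding poly.specializes_def
  by (intro exI[of _ "pvar i - pvar j"] exI[of _ "pvar i + pvar j"] exI[of _ "inv_sum i j"])
     (simp add: pvar_add_neq_0 inv_sum_inverse[OF assms] ratio_def poly.hom_diff)

interpretation eval0: specialization "\<lambda>p :: rat poly. poly p 0"
  by unfold_locales simp_all

text \<open>
  The exponent \<open>m i\<close> moved by a power of an infinitesimal.  The powers are different, so that equal exponents
  become distinct; and they decrease in size as \<open>i\<close> grows, so that \<open>0 / 0\<close> becomes 1 for \<open>i < j\<close>.  The
  successor makes the perturbation vanish at zero also for \<open>i = 0\<close>.
\<close>

definition perturbed :: "(nat \<Rightarrow> nat) \<Rightarrow> nat \<Rightarrow> rat poly" where
  "perturbed m i = [:of_nat (m i):] + monom 1 (Suc i)"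

lemma coeff_perturbed: "coeff (perturbed m i) (Suc l) = (if l = i then 1 else 0)"
  by (auto simp: perturbed_def)

lemma perturbed_inject: "perturbed m i = perturbed m j \<longleftrightarrow> i = j"
  by (metis coeff_perturbed zero_neq_one)

lemma perturbed_add_neq_0: "perturbed m i + perturbed m j \<noteq> 0"
proof
  assume "perturbed m i + perturbed m j = 0"
  hence "coeff (perturbed m i + perturbed m j) (Suc i) = 0" by simp
  thus False by (simp add: coeff_perturbed split: if_splits)
qed

lemma specializes_exponent_ratio:
  assumes "i < j"
  shows "eval0.specializes (Fract (perturbed m i - perturbed m j) (perturbed m i + perturbed m j))
           (exponent_ratio m i j)"
proof (cases "m i = 0 \<and> m j = 0")
  case True
  let ?t = "monom 1 (Suc i) :: rat poly" and ?u = "monom 1 (j - i) :: rat poly"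
  have "perturbed m j = ?t * ?u"
    using True assms by (simp add: perturbed_def mult_monom)
  hence eq: "perturbed m i - perturbed m j = ?t * (1 - ?u)" "perturbed m i + perturbed m j = ?t * (1 + ?u)"
    using True by (simp_all add: perturbed_def algebra_simps)
  \<comment> \<open>The value at zero of numerator and denominator is 0 until the larger infinitesimal is cancelled.\<close>
  have "Fract (perturbed m i - perturbed m j) (perturbed m i + perturbed m j) = Fract (1 - ?u) (1 + ?u)"
    unfolding eq by (rule mult_fract_cancel) (simp add: monom_eq_0_iff)
  moreover have "1 + ?u \<noteq> 0" using perturbed_add_neq_0[of m i j] eq by auto
  moreover have "poly ?u 0 = 0" using assms by (simp add: poly_monom)
  ultimately show ?thesis
    unfolding eval0.specializes_def
    by (intro exI[of _ "1 - ?u"] exI[of _ "1 + ?u"] exI[of _ 1]) (use True in \<open>simp add: exponent_ratio_def\<close>)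
next
  case False
  have "(of_nat (m i) + of_nat (m j) :: rat) \<noteq> 0"
    using False by (simp flip: of_nat_add)
  moreover have "poly (perturbed m l) 0 = of_nat (m l)" for l
    by (simp add: perturbed_def poly_monom)
  ultimately show ?thesis
    unfolding eval0.specializes_def
    by (intro exI[of _ "perturbed m i - perturbed m j"] exI[of _ "perturbed m i + perturbed m j"]
          exI[of _ "1 / (of_nat (m i) + of_nat (m j))"])
       (use False in \<open>auto simp add: exponent_ratio_def perturbed_add_neq_0\<close>)
qed

section \<open>The polynomial component of the pair product\<close>

text \<open>
  Induction along the expansions of the Pfaffian: an odd set splits off a single variable with
  the factor 1, an even one splits off a pair.  The expansions of the series and of its weight
  have the same signs, so they match term by term.
\<close>

theorem multinomial_component_pair_prod:
  assumes "finite S"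
  shows "multinomial_component S (pair_prod ratio S) (\<lambda>m. pair_prod (exponent_ratio m) S)"
  using assms
proof (induction "card S" arbitrary: S rule: less_induct)
  case less
  note fin = \<open>finite S\<close>
  have IH: "multinomial_component T (pair_prod ratio T) (\<lambda>m. pair_prod (exponent_ratio m) T)"
    if "T \<subset> S" for T
    using that fin by (intro less.hyps) (auto intro: psubset_card_mono finite_subset)
  have restrict: "pair_prod (exponent_ratio (restrict m T)) T = pair_prod (exponent_ratio m) T" for m T
    by (rule pair_prod_cong) (simp add: exponent_ratio_def)
  have inj_pvar: "inj_on pvar S" by (auto simp: inj_on_def pvar_inject)
  have inj_perturbed: "inj_on (perturbed m) S" for m by (auto simp: inj_on_def perturbed_inject)
  consider "S = {}" | "odd (card S)" | "even (card S)" "S \<noteq> {}" by auto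
  thus ?case
  proof cases
    case 1
    thus ?thesis using multinomial_component_empty by simp
  next
    case 2
    let ?c = "\<lambda>j. (-1) ^ card {i \<in> S. i < j} :: rat"
    have "multinomial_component S (pair_prod ratio (S - {j})) (\<lambda>m. pair_prod (exponent_ratio m) (S - {j}))"
      if j: "j \<in> S" for j
    proof -
      have "multinomial_component ((S - {j}) \<union> {j}) (pair_prod ratio (S - {j}) * 1)
              (\<lambda>m. pair_prod (exponent_ratio (restrict m (S - {j}))) (S - {j}) * 1)"
        by (rule multinomial_component_union[OF IH multinomial_component_singleton]) (use fin j in auto)
      moreover have "(S - {j}) \<union> {j} = S" using j by auto
      ultimately show ?thesis by (simp add: restrict)
    qed
    hence "multinomial_component S (\<Sum>j\<in>S. lconst (?c j) * pair_prod ratio (S - {j}))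
             (\<lambda>m. \<Sum>j\<in>S. ?c j * pair_prod (exponent_ratio m) (S - {j}))"
      by (rule multinomial_component_sum)
    moreover have "pair_prod ratio S = (\<Sum>j\<in>S. lconst (?c j) * pair_prod ratio (S - {j}))"
      unfolding lconst_sign
      by (rule poly.pair_prod_specialized_odd[OF fin inj_pvar pvar_add_neq_0 specializes_ratio 2])
    moreover have "pair_prod (exponent_ratio m) S = (\<Sum>j\<in>S. ?c j * pair_prod (exponent_ratio m) (S - {j}))" for m
      by (rule eval0.pair_prod_specialized_odd[OF fin inj_perturbed perturbed_add_neq_0 specializes_exponent_ratio 2])
    ultimately show ?thesis by simp
  next
    case 3
    define s where "s = Min S"
    define T where "T = S - {s}"
    have s: "s \<in> S" using 3 fin by (simp add: s_def)
    have s_less: "s < j" if "j \<in> T" for j using that fin by (auto simp: T_def s_def less_le)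
    let ?c = "\<lambda>j. (-1) ^ card {i \<in> T. i < j} :: rat"
    have "multinomial_component S (ratio s j * pair_prod ratio (T - {j}))
            (\<lambda>m. exponent_ratio m s j * pair_prod (exponent_ratio m) (T - {j}))"
      if j: "j \<in> T" for j
    proof -
      have "multinomial_component ({s, j} \<union> (T - {j})) (ratio s j * pair_prod ratio (T - {j}))
              (\<lambda>m. exponent_ratio (restrict m {s, j}) s j * pair_prod (exponent_ratio (restrict m (T - {j}))) (T - {j}))"
        by (rule multinomial_component_union[OF multinomial_component_ratio[OF s_less[OF j]] IH])
           (use fin j s in \<open>auto simp: T_def\<close>)
      moreover have "{s, j} \<union> (T - {j}) = S" using j s by (auto simp: T_def)
      moreover have "exponent_ratio (restrict m {s, j}) s j = exponent_ratio m s j" for m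
        by (simp add: exponent_ratio_def)
      ultimately show ?thesis by (simp add: restrict)
    qed
    hence "multinomial_component S (\<Sum>j\<in>T. lconst (?c j) * (ratio s j * pair_prod ratio (T - {j})))
             (\<lambda>m. \<Sum>j\<in>T. ?c j * (exponent_ratio m s j * pair_prod (exponent_ratio m) (T - {j})))"
      by (rule multinomial_component_sum)
    moreover have "pair_prod ratio S = (\<Sum>j\<in>T. lconst (?c j) * (ratio s j * pair_prod ratio (T - {j})))"
      unfolding lconst_sign mult.assoc[symmetric] s_def T_def
      by (rule poly.pair_prod_specialized_even[OF fin inj_pvar pvar_add_neq_0 specializes_ratio 3])
    moreover have "pair_prod (exponent_ratio m) S =
        (\<Sum>j\<in>T. ?c j * (exponent_ratio m s j * pair_prod (exponent_ratio m) (T - {j})))" for m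
      unfolding mult.assoc[symmetric] s_def T_def
      by (rule eval0.pair_prod_specialized_even[OF fin inj_perturbed perturbed_add_neq_0 specializes_exponent_ratio 3])
    ultimately show ?thesis by simp
  qed
qed

interpretation fraction: specialization "\<lambda>p :: mpoly. Fract p 1"
  by unfold_locales (simp_all add: One_fract_def)

lemma pairs_eq: "pairs k = {(i, j). i \<in> {1..k} \<and> j \<in> {1..k} \<and> i < j}"
  by (auto simp: pairs_def)

lemma prod_Fract: "(\<Prod>i\<in>A. Fract (p i) (q i)) = Fract (\<Prod>i\<in>A. p i) (\<Prod>i\<in>A. q i)"
  by (induction A rule: infinite_finite_induct) (simp_all add: One_fract_def)

text \<open>
  The series in a given set of variables are closed under all the operations that occur, so it is easiest
  to check there that the numerator involves only \<open>x\<^sub>1, \<dots>, x\<^sub>k\<close>.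
\<close>

lemma polys_inI:
  assumes "laurent_in {1..k} (laurent_of_poly p)"
  shows "p \<in> polys_in k"
  unfolding polys_in_def
proof safe
  fix m i assume m: "m \<in> Poly_Mapping.keys p" and i: "i \<in> Poly_Mapping.keys m"
  have "lcoeff (laurent_of_poly p) (Poly_Mapping.map int m) \<noteq> 0"
    using m by (simp add: lcoeff_laurent_of_poly map_nat_int lookup_map_int in_keys_iff)
  hence "Poly_Mapping.keys (Poly_Mapping.map int m) \<subseteq> {1..k}"
    using assms by (auto simp: laurent_in_def)
  moreover have "i \<in> Poly_Mapping.keys (Poly_Mapping.map int m)"
    using i by (simp add: in_keys_iff lookup_map_int)
  ultimately show "i \<in> {1..k}" by blast
qed

lemma expansion_pair_prod:
  "expansion k ((\<Prod>(i, j)\<in>pairs k. (rvar i - rvar j) / (rvar i + rvar j)) *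
      falling_factorial (\<Sum>i=1..k. rvar i) n) =
   pair_prod ratio {1..k} * falling_factorial (\<Sum>i=1..k. lvar i) n"
proof -
  define p where "p = (\<Prod>(i, j)\<in>pairs k. pvar i - pvar j) * falling_factorial (\<Sum>i=1..k. pvar i) n"
  have "(\<Prod>(i, j)\<in>pairs k. (rvar i - rvar j) / (rvar i + rvar j)) =
        (\<Prod>(i, j)\<in>pairs k. Fract (pvar i - pvar j) (pvar i + pvar j))"
    by (simp add: rvar_def)
  also have "\<dots> = Fract (\<Prod>(i, j)\<in>pairs k. pvar i - pvar j) (denom k)"
    by (simp add: case_prod_unfold prod_Fract denom_def)
  finally have "(\<Prod>(i, j)\<in>pairs k. (rvar i - rvar j) / (rvar i + rvar j)) *
      falling_factorial (\<Sum>i=1..k. rvar i) n = Fract p (denom k)"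
    by (simp add: rvar_def p_def fraction.hom_falling_factorial flip: fraction.hom_sum)
      (simp flip: fraction.hom_falling_factorial)
  moreover have L: "laurent_of_poly p =
      (\<Prod>(i, j)\<in>pairs k. lvar i - lvar j) * falling_factorial (\<Sum>i=1..k. lvar i) n"
    by (simp add: p_def poly.hom_mult poly.hom_prod poly.hom_falling_factorial poly.hom_sum poly.hom_diff case_prod_unfold)
  moreover have "p \<in> polys_in k"
    by (rule polys_inI, unfold L)
       (auto intro!: laurent_in_mult laurent_in_prod laurent_in_diff laurent_in_falling_factorial
          laurent_in_sum laurent_in_lvar simp: pairs_def)
  ultimately show ?thesis
    by (simp add: expansion_def numerator_Fract pair_prod_def ratio_def pairs_eq prod.distrib case_prod_unfold mult_ac)
qed

theorem theorem6:
  fixes k n :: nat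
  assumes "k \<ge> 1"
  shows "polynomial_component k
           ((\<Prod>(i, j)\<in>pairs k. (rvar i - rvar j) / (rvar i + rvar j)) *
             falling_factorial (\<Sum>i=1..k. rvar i) n) =
         laurent_of_poly
           (\<Sum>m | m \<in> {1..k} \<rightarrow>\<^sub>E UNIV \<and> (\<Sum>i=1..k. m i) = n.
              pconst ((\<Prod>(i, j)\<in>pairs k.
                         if m i = 0 \<and> m j = 0 then 1
                         else (of_nat (m i) - of_nat (m j)) / (of_nat (m i) + of_nat (m j))) *
                      (fact n / (\<Prod>i=1..k. fact (m i)))) *
              (\<Prod>i=1..k. falling_factorial (pvar i) (m i)))"
  unfolding polynomial_component_eq expansion_pair_prod
  using multinomial_component_pair_prod[of "{1..k}"]
  by (simp add: multinomial_component_def multinomial_sum_def exponents_def pair_prod_def pairs_eq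
      exponent_ratio_def lconst_def poly.hom_sum poly.hom_mult poly.hom_prod poly.hom_falling_factorial)

end
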